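(* Let $\Sigma_A$ be an irreducible shift of finite type. Then for every $\omega\in\Sigma_A$, $$h^B(\mathrm{ML}_\omega(\Sigma_A,\sigma))=0\quad\text{and}\quad h^P(\mathrm{ML}_\omega(\Sigma_A,\sigma))=h(\Sigma_A),$$ that is, $$\dim_H(\mathrm{ML}_\omega(\Sigma_A,\sigma))=0\quad\text{and}\quad\dim_P(\mathrm{ML}_\omega(\Sigma_A,\sigma))=\dim_H(\Sigma_A).$$
   Context: $\mathbb{N}=\{0,1,2,\dots\}$. Let $\mathcal{A}=\{1,\dots,K\}$ be a finite alphabet, $\Sigma=\mathcal{A}^{\mathbb{N}}$, $\sigma$ the shift map $(\sigma x)_i=x_{i+1}$, and equip $\Sigma$ with the metric $\rho(x,y)=K^{-\min\{n\ge 0:\,x_n\neq y_n\}}$ for $x\ne y$, $\rho(x,x)=0$. For a $K\times K$ matrix $A$ with entries in $\{0,1\}$, the shift of finite type is $\Sigma_A=\{x\in\Sigma: A_{x_i,x_{i+1}}=1\text{ for all }i\in\mathbb{N}\}$ with the shift map $\sigma$. It is irreducible if for any $i,j$ there is $r>0$ with $(A^r)_{i,j}>0$. $h(\Sigma_A)$ denotes the topological entropy of $(\Sigma_A,\sigma)$. For a topological dynamical system $(X,T)$ with metric $\rho$, $(x,y)$ is a mean Li--Yorke pair if $\liminf_{n\to\infty}\frac1n\sum_{i=0}^{n-1}\rho(T^ix,T^iy)=0$ and $\limsup_{n\to\infty}\frac1n\sum_{i=0}^{n-1}\rho(T^ix,T^iy)>0$; $\mathrm{ML}_x(X,T)=\{y\in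 X:(x,y)\text{ is a mean Li--Yorke pair}\}$. For a finite word $W$ over $\mathcal{A}$ let $|W|$ be its length and $[W]=\{x\in\Sigma: x_0\cdots x_{|W|-1}=W\}$ its cylinder. Let $Z\subset\Sigma$. Bowen entropy: for $s\ge0$, $N\in\mathbb{N}$, $\mathcal{H}^s_N(Z)=\inf_{\mathcal{W}}\sum_{W\in\mathcal{W}}e^{-s|W|}$, the infimum being over all (countable) covers $\mathcal W$ of $Z$ by cylinders of length larger than $N$; $\mathcal{H}^s(Z)=\lim_{N\to\infty}\mathcal{H}^s_N(Z)$ and $h^B(Z)=\inf\{s\ge0:\mathcal{H}^s(Z)=0\}$. Packing entropy: $\mathcal{P}^s_N(Z)=\sup_{\mathcal W}\sum_{W\in\mathcal W}e^{-s|W|}$, the supremum being over all families $\mathcal W$ of pairwise disjoint cylinders with $[W]\cap Z\ne\emptyset$ and $|W|\ge N$ for every $W\in\mathcal W$; $\mathcal{P}^s_*(Z)=\lim_{N\to\infty}\mathcal{P}^s_N(Z)$; $\mathcal{P}^s(Z)=\inf\{\sum_{i\in\mathbb{N}}\mathcal{P}^s_*(Z_i):\bigcup_{i\in\mathbb{N}}Z_i\supset Z\}$; $h^P(Z)=\inf\{s\ge0:\mathcal{P}^s(Z)=0\}$. $\dim_H$ and $\dim_P$ are Hausdorff and packing dimension with respect to $\rho$ (the empty set has dimension $0$). *)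

theory Defs
  imports "HOL-Analysis.Analysis"
begin

section \<open>Topological dynamics and dimension in a metric space\<close>

context Metric_space
begin

definition mean_li_yorke_pair :: "('a \<Rightarrow> 'a) \<Rightarrow> 'a \<Rightarrow> 'a \<Rightarrow> bool" where
  "mean_li_yorke_pair T x y \<longleftrightarrow>
     liminf (\<lambda>n. ereal ((\<Sum>i<n. d ((T ^^ i) x) ((T ^^ i) y)) / real n)) = 0 \<and>
     limsup (\<lambda>n. ereal ((\<Sum>i<n. d ((T ^^ i) x) ((T ^^ i) y)) / real n)) > 0"

definition mean_li_yorke_set :: "('a \<Rightarrow> 'a) \<Rightarrow> 'a \<Rightarrow> 'a set" where
  "mean_li_yorke_set T x = {y \<in> M. mean_li_yorke_pair T x y}"

definition separated_set :: "('a \<Rightarrow> 'a) \<Rightarrow> nat \<Rightarrow> real \<Rightarrow> 'a set \<Rightarrow> bool" where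
  "separated_set T n \<epsilon> E \<longleftrightarrow>
     E \<subseteq> M \<and> (\<forall>x\<in>E. \<forall>y\<in>E. x \<noteq> y \<longrightarrow> (\<exists>i<n. d ((T ^^ i) x) ((T ^^ i) y) > \<epsilon>))"

text \<open>
  The Bowen--Dinaburg definition of the entropy of \<open>(M, T)\<close>, by \<open>(n, \<epsilon>)\<close>-separated sets.
  The limit as \<open>\<epsilon>\<close> tends to 0 is a supremum because the growth rate is antitone in \<open>\<epsilon>\<close>.
\<close>

definition topological_entropy :: "('a \<Rightarrow> 'a) \<Rightarrow> ereal" where
  "topological_entropy T =
     (SUP \<epsilon>\<in>{0<..}. limsup (\<lambda>n.
        SUP E\<in>{E. finite E \<and> separated_set T n \<epsilon> E}. ereal (ln (real (card E)) / real n)))"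

definition mdiameter :: "'a set \<Rightarrow> real" where
  "mdiameter U = (if U = {} then 0 else SUP (x, y)\<in>U \<times> U. d x y)"

text \<open>
  The \<open>s\<close>-th power of the diameter, where the power with exponent 0 is 1 for every nonempty set
  (whereas \<open>0 powr 0 = 0\<close>) and the empty set contributes 0 for every \<open>s\<close>.
\<close>

definition hausdorff_gauge :: "real \<Rightarrow> 'a set \<Rightarrow> ennreal" where
  "hausdorff_gauge s U =
     (if U = {} then 0 else if s = 0 then 1 else ennreal (mdiameter U powr s))"

definition hausdorff_premeasure :: "real \<Rightarrow> real \<Rightarrow> 'a set \<Rightarrow> ennreal" where
  "hausdorff_premeasure s \<delta> Z =
     (INF U\<in>{U :: nat \<Rightarrow> 'a set. Z \<subseteq> (\<Union>i. U i) \<and> (\<forall>i. mbounded (U i) \<and> mdiameter (U i) \<le> \<delta>)}.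
        \<Sum>i. hausdorff_gauge s (U i))"

definition hausdorff_outer_measure :: "real \<Rightarrow> 'a set \<Rightarrow> ennreal" where
  "hausdorff_outer_measure s Z = (SUP \<delta>\<in>{0<..}. hausdorff_premeasure s \<delta> Z)"

definition hausdorff_dim :: "'a set \<Rightarrow> ereal" where
  "hausdorff_dim Z = (INF s\<in>{s. s \<ge> 0 \<and> hausdorff_outer_measure s Z = 0}. ereal s)"

text \<open>
  A packing of \<open>Z\<close> is a countable set of pairs (centre, radius) with centres in \<open>Z\<close> whose closed
  balls are pairwise disjoint. A ball counts with twice its radius rather than with its diameter.
\<close>

definition ball_packing :: "real \<Rightarrow> 'a set \<Rightarrow> ('a \<times> real) set \<Rightarrow> bool" where
  "ball_packing \<delta> Z C \<longleftrightarrow>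
     countable C \<and> (\<forall>(x, r)\<in>C. x \<in> Z \<and> 0 < r \<and> r \<le> \<delta>) \<and>
     pairwise (\<lambda>(x, r) (y, t). disjnt (mcball x r) (mcball y t)) C"

definition ball_packing_premeasure :: "real \<Rightarrow> real \<Rightarrow> 'a set \<Rightarrow> ennreal" where
  "ball_packing_premeasure s \<delta> Z =
     (SUP C\<in>{C. ball_packing \<delta> Z C}. \<Sum>\<^sub>\<infinity>(x, r)\<in>C. ennreal ((2 * r) powr s))"

definition ball_packing_content :: "real \<Rightarrow> 'a set \<Rightarrow> ennreal" where
  "ball_packing_content s Z = (INF \<delta>\<in>{0<..}. ball_packing_premeasure s \<delta> Z)"

definition ball_packing_outer_measure :: "real \<Rightarrow> 'a set \<Rightarrow> ennreal" where
  "ball_packing_outer_measure s Z =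
     (INF Y\<in>{Y :: nat \<Rightarrow> 'a set. (\<forall>i. Y i \<subseteq> M) \<and> Z \<subseteq> (\<Union>i. Y i)}.
        \<Sum>i. ball_packing_content s (Y i))"

definition packing_dim :: "'a set \<Rightarrow> ereal" where
  "packing_dim Z = (INF s\<in>{s. s \<ge> 0 \<and> ball_packing_outer_measure s Z = 0}. ereal s)"

end


section \<open>Symbolic dynamics\<close>

text \<open>
  The alphabet is a finite type \<open>'k\<close> with \<open>K = CARD('k)\<close> letters, so the full shift is the whole
  type \<open>nat \<Rightarrow> 'k\<close>.
\<close>

definition shift :: "(nat \<Rightarrow> 'k) \<Rightarrow> nat \<Rightarrow> 'k" where
  "shift x = (\<lambda>i. x (Suc i))"

definition rho :: "(nat \<Rightarrow> 'k::finite) \<Rightarrow> (nat \<Rightarrow> 'k) \<Rightarrow> real" where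
  "rho x y = (if x = y then 0 else inverse (real CARD('k) ^ (LEAST n. x n \<noteq> y n)))"

lemma Metric_space_rho: "Metric_space M (rho :: (nat \<Rightarrow> 'k::finite) \<Rightarrow> _)"
proof
  fix x y z :: "nat \<Rightarrow> 'k"
  show "0 \<le> rho x y"
    by (simp add: rho_def)
  show "rho x y = rho y x"
    by (simp add: rho_def eq_commute)
  show "rho x y = 0 \<longleftrightarrow> x = y"
    by (simp add: rho_def)
  show "rho x z \<le> rho x y + rho y z"
  proof (cases "x = y \<or> y = z \<or> x = z")
    case True
    then show ?thesis
      by (auto simp: rho_def)
  next
    case False
    define l where "l u v = (LEAST n. u n \<noteq> v n)" for u v :: "nat \<Rightarrow> 'k"
    have rho_l: "rho u v = inverse (real CARD('k) ^ l u v)" if "u \<noteq> v" for u v :: "nat \<Rightarrow> 'k"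
      using that by (simp add: rho_def l_def)
    have mono: "inverse (real CARD('k) ^ n) \<le> inverse (real CARD('k) ^ m)" if "m \<le> n" for m n
    proof (rule le_imp_inverse_le)
      show "real CARD('k) ^ m \<le> real CARD('k) ^ n"
        using that by (intro power_increasing) (simp_all add: Suc_leI)
    qed simp
    obtain k where "x k \<noteq> z k"
      using False by blast
    then have "x (l x z) \<noteq> z (l x z)"
      unfolding l_def by (rule LeastI)
    then consider "x (l x z) \<noteq> y (l x z)" | "y (l x z) \<noteq> z (l x z)"
      by force
    then show ?thesis
    proof cases
      case 1
      then have "l x y \<le> l x z"
        unfolding l_def[of x y] by (rule Least_le)
      then have "rho x z \<le> rho x y"
        using False by (metis rho_l mono)
      moreover have "0 \<le> rho y z"
        by (simp add: rho_def)
      ultimately show ?thesis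
        by linarith
    next
      case 2
      then have "l y z \<le> l x z"
        unfolding l_def[of y z] by (rule Least_le)
      then have "rho x z \<le> rho y z"
        using False by (metis rho_l mono)
      moreover have "0 \<le> rho x y"
        by (simp add: rho_def)
      ultimately show ?thesis
        by linarith
    qed
  qed
qed

primrec matrix_pow :: "'a::semiring_1 ^ 'k ^ 'k \<Rightarrow> nat \<Rightarrow> 'a ^ 'k ^ 'k" where
  "matrix_pow A 0 = mat 1"
| "matrix_pow A (Suc r) = A ** matrix_pow A r"

definition irreducible_matrix :: "nat ^ 'k ^ 'k \<Rightarrow> bool" where
  "irreducible_matrix A \<longleftrightarrow> (\<forall>i j. \<exists>r>0. matrix_pow A r $ i $ j > 0)"

definition SFT :: "nat ^ 'k ^ 'k \<Rightarrow> (nat \<Rightarrow> 'k) set" where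
  "SFT A = {x. \<forall>i. A $ x i $ x (Suc i) = 1}"

definition cylinder :: "'k list \<Rightarrow> (nat \<Rightarrow> 'k) set" where
  "cylinder W = {x. \<forall>i<length W. x i = W ! i}"


subsection \<open>Bowen entropy\<close>

text \<open>Families of cylinders are given as sets of words; over a finite alphabet these are countable.\<close>

definition bowen_premeasure :: "real \<Rightarrow> nat \<Rightarrow> (nat \<Rightarrow> 'k::finite) set \<Rightarrow> ennreal" where
  "bowen_premeasure s N Z =
     (INF \<W>\<in>{\<W>. Z \<subseteq> (\<Union>W\<in>\<W>. cylinder W) \<and> (\<forall>W\<in>\<W>. length W > N)}.
        \<Sum>\<^sub>\<infinity>W\<in>\<W>. ennreal (exp (- s * real (length W))))"

definition bowen_measure :: "real \<Rightarrow> (nat \<Rightarrow> 'k::finite) set \<Rightarrow> ennreal" where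
  "bowen_measure s Z = lim (\<lambda>N. bowen_premeasure s N Z)"

definition bowen_entropy :: "(nat \<Rightarrow> 'k::finite) set \<Rightarrow> ereal" where
  "bowen_entropy Z = (INF s\<in>{s. s \<ge> 0 \<and> bowen_measure s Z = 0}. ereal s)"


subsection \<open>Packing entropy\<close>

definition packing_premeasure :: "real \<Rightarrow> nat \<Rightarrow> (nat \<Rightarrow> 'k::finite) set \<Rightarrow> ennreal" where
  "packing_premeasure s N Z =
     (SUP \<W>\<in>{\<W>. pairwise (\<lambda>V W. disjnt (cylinder V) (cylinder W)) \<W> \<and>
                  (\<forall>W\<in>\<W>. cylinder W \<inter> Z \<noteq> {} \<and> length W \<ge> N)}.
        \<Sum>\<^sub>\<infinity>W\<in>\<W>. ennreal (exp (- s * real (length W))))"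

definition packing_content :: "real \<Rightarrow> (nat \<Rightarrow> 'k::finite) set \<Rightarrow> ennreal" where
  "packing_content s Z = lim (\<lambda>N. packing_premeasure s N Z)"

definition packing_measure :: "real \<Rightarrow> (nat \<Rightarrow> 'k::finite) set \<Rightarrow> ennreal" where
  "packing_measure s Z =
     (INF Y\<in>{Y :: nat \<Rightarrow> (nat \<Rightarrow> 'k) set. Z \<subseteq> (\<Union>i. Y i)}. \<Sum>i. packing_content s (Y i))"

definition packing_entropy :: "(nat \<Rightarrow> 'k::finite) set \<Rightarrow> ereal" where
  "packing_entropy Z = (INF s\<in>{s. s \<ge> 0 \<and> packing_measure s Z = 0}. ereal s)"

end

theory Submission
  imports Defs
begin

text \<open>
  Closed balls of \<open>rho\<close> are cylinders, so Hausdorff and packing dimension are Bowen and packing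
  entropy divided by \<open>ln K\<close>. If \<open>y\<close> is in the mean Li--Yorke set of \<open>\<omega>\<close>, then infinitely many prefixes
  of \<open>y\<close> lie in small Hamming balls around prefixes of \<open>\<omega>\<close>, and such balls contain subexponentially
  many words; hence the Bowen entropy is 0. The packing entropy is at most the growth rate of the
  language. For the lower bound, \<open>\<omega>\<close> is modified on extremely long, sparse windows, where loops at a
  letter that recurs in \<open>\<omega>\<close> are chosen freely. The resulting closed set consists of points that are
  mean Li--Yorke paired with \<open>\<omega>\<close> and have almost maximal complexity at the ends of the windows; by a
  Baire argument a piece of any countable cover is dense in a part of it, so its packing entropy is
  almost maximal.
\<close>

section \<open>Sums in the extended nonnegative reals\<close>

text \<open>The point \<open>\<omega>\<close> is arbitrary and need not be recurrent, but some
  letter \<open>b\<close> occurs in it infinitely often, and this is enough to leave its orbit and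
  rejoin it. Irreducibility does not provide connecting paths of every large length, so each
  excursion must have an exactly fitting length; pigeonholing the occurrences of \<open>b\<close>
  modulo a common loop length \<open>L\<close> achieves this. Each property of a modified point is
  read off at one end of a window. When a window ends, free loops fill almost all of the prefix,
  which yields nearly maximal word counts and, as the block of \<open>\<omega>\<close> is forbidden
  there, a positive proportion of disagreements. When the next window begins, the copied stretch of
  \<open>\<omega>\<close> fills almost all of the prefix, so the average is small. Both need
  \<open>r n\<close> to be negligible against \<open>r (Suc n)\<close>, hence the growing factor in
  \<open>gap\<close>. Entropies and dimensions are matched at positive exponents; at exponent 0 only
  the empty set is null. A one-letter alphabet, for which \<open>ln K = 0\<close>, is treated
  apart.\<close>

lemma infsum_ennreal_leI:
  fixes f :: "'a \<Rightarrow> ennreal"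
  assumes "\<And>F. finite F \<Longrightarrow> F \<subseteq> A \<Longrightarrow> sum f F \<le> B"
  shows "infsum f A \<le> B"
  by (subst nonneg_infsum_complete) (auto intro!: SUP_least assms)

lemma sum_le_infsum_ennreal:
  fixes f :: "'a \<Rightarrow> ennreal"
  assumes "finite F" "F \<subseteq> A"
  shows "sum f F \<le> infsum f A"
  by (subst nonneg_infsum_complete) (auto intro!: SUP_upper assms)

lemma le_infsum_ennreal:
  fixes f :: "'a \<Rightarrow> ennreal"
  assumes "x \<in> A"
  shows "f x \<le> infsum f A"
  using sum_le_infsum_ennreal[of "{x}" A f] assms by simp

lemma infsum_cmult_ennreal:
  fixes f :: "'a \<Rightarrow> ennreal"
  shows "infsum (\<lambda>x. c * f x) A = c * infsum f A"
proof -
  have "infsum (\<lambda>x. c * f x) A = (SUP F\<in>{F. finite F \<and> F \<subseteq> A}. c * sum f F)"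
    by (subst nonneg_infsum_complete) (simp_all add: sum_distrib_left)
  also have "\<dots> = c * (SUP F\<in>{F. finite F \<and> F \<subseteq> A}. sum f F)"
    by (rule SUP_mult_left_ennreal[symmetric])
  also have "(SUP F\<in>{F. finite F \<and> F \<subseteq> A}. sum f F) = infsum f A"
    by (subst nonneg_infsum_complete) simp_all
  finally show ?thesis .
qed

lemma suminf_eq_infsum_ennreal:
  fixes f :: "nat \<Rightarrow> ennreal"
  shows "suminf f = infsum f UNIV"
proof (rule antisym)
  show "suminf f \<le> infsum f UNIV"
    by (rule suminf_le_const[OF summableI]) (simp add: sum_le_infsum_ennreal)
  show "infsum f UNIV \<le> suminf f"
    by (rule infsum_ennreal_leI) (simp add: sum_le_suminf summableI)
qed

lemma infsum_le_infsum_ennreal_bij: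
  fixes f :: "'a \<Rightarrow> ennreal" and g :: "'b \<Rightarrow> ennreal"
  assumes "inj_on h A" "h ` A \<subseteq> B" "\<And>x. x \<in> A \<Longrightarrow> f x \<le> g (h x)"
  shows "infsum f A \<le> infsum g B"
proof (rule infsum_ennreal_leI)
  fix F assume F: "finite F" "F \<subseteq> A"
  have "sum f F \<le> (\<Sum>x\<in>F. g (h x))"
    using F assms(3) by (intro sum_mono) auto
  also have "\<dots> = sum g (h ` F)"
    using F assms(1) by (subst sum.reindex) (auto intro: inj_on_subset)
  also have "\<dots> \<le> infsum g B"
    using F assms(2) by (intro sum_le_infsum_ennreal) auto
  finally show "sum f F \<le> infsum g B" .
qed

lemma suminf_halves_ennreal:
  assumes "0 \<le> (e::real)"
  shows "(\<Sum>i. ennreal (e * (1/2) ^ Suc i)) = ennreal e"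
  using sums_mult[OF power_half_series, of e] assms
  by (intro suminf_ennreal_eq) auto

lemma ennreal_eq_0_if_le_all:
  fixes x :: ennreal
  assumes "\<And>e::real. e > 0 \<Longrightarrow> x \<le> ennreal e"
  shows "x = 0"
  using ennreal_le_epsilon[of 0 x] assms by auto


section \<open>Words and cylinders\<close>

definition pre :: "(nat \<Rightarrow> 'k) \<Rightarrow> nat \<Rightarrow> 'k list" where
  "pre x n = map x [0..<n]"

definition words :: "(nat \<Rightarrow> 'k) set \<Rightarrow> nat \<Rightarrow> 'k list set" where
  "words X n = (\<lambda>x. pre x n) ` X"

lemma length_pre [simp]: "length (pre x n) = n"
  by (simp add: pre_def)

lemma nth_pre [simp]: "i < n \<Longrightarrow> pre x n ! i = x i"
  by (simp add: pre_def)

lemma pre_eq_iff: "pre x n = pre y n \<longleftrightarrow> (\<forall>i<n. x i = y i)"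
  by (auto simp: pre_def map_eq_conv)

lemma pre_add: "pre x (m + n) = pre x m @ pre (\<lambda>i. x (m + i)) n"
  by (rule nth_equalityI) (auto simp: nth_append)

lemma mem_cylinder_iff: "x \<in> cylinder W \<longleftrightarrow> pre x (length W) = W"
  by (auto simp: cylinder_def list_eq_iff_nth_eq)

lemma mem_cylinder_pre_iff: "y \<in> cylinder (pre x n) \<longleftrightarrow> (\<forall>i<n. y i = x i)"
  by (simp add: mem_cylinder_iff pre_eq_iff)

lemma cylinder_nonempty: "cylinder W \<noteq> {}"
  by (auto simp: cylinder_def intro!: exI[of _ "\<lambda>i. W ! i"])

lemma length_words: "W \<in> words X n \<Longrightarrow> length W = n"
  by (auto simp: words_def)

lemma mem_words_iff: "W \<in> words X n \<longleftrightarrow> length W = n \<and> cylinder W \<inter> X \<noteq> {}"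
  by (auto simp: words_def mem_cylinder_iff image_iff) (metis)

lemma finite_lists_length: "finite {W :: 'k::finite list. length W = n}"
  using finite_lists_length_eq[of "UNIV :: 'k set" n] by simp

lemma card_lists_length: "card {W :: 'k::finite list. length W = n} = CARD('k) ^ n"
  using card_lists_length_eq[of "UNIV :: 'k set" n] by simp

lemma finite_words [simp]: "finite (words (X :: (nat \<Rightarrow> 'k::finite) set) n)"
  by (rule finite_subset[OF _ finite_lists_length[of n]]) (auto simp: length_words)

lemma card_words_pos: "X \<noteq> {} \<Longrightarrow> card (words (X :: (nat \<Rightarrow> 'k::finite) set) n) > 0"
  using finite_words[of X n] by (auto simp: card_gt_0_iff words_def simp del: finite_words)

lemma disjnt_cylinder_same_length:
  "length V = length W \<Longrightarrow> V \<noteq> W \<Longrightarrow> disjnt (cylinder V) (cylinder W)"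
  by (auto simp: disjnt_def mem_cylinder_iff)

text \<open>Sorted by length, the words weigh at most \<open>exp ((u - s) * n)\<close> at each
  length \<open>n\<close>, so only a geometric tail from \<open>N\<close> on is left. Covers and
  packings are both estimated this way.\<close>

lemma infsum_words_le:
  fixes \<W> :: "'k::finite list set"
  assumes card: "\<And>n. n \<ge> N \<Longrightarrow> real (card {W\<in>\<W>. length W = n}) \<le> exp (u * real n)"
    and len: "\<And>W. W \<in> \<W> \<Longrightarrow> length W \<ge> N" and "u < s"
  shows "(\<Sum>\<^sub>\<infinity>W\<in>\<W>. ennreal (exp (- s * real (length W)))) \<le> ennreal (exp (u - s) ^ N / (1 - exp (u - s)))"
proof (rule infsum_ennreal_leI)
  fix F assume F: "finite F" "F \<subseteq> \<W>"
  define r where "r = exp (u - s)"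
  have r: "0 < r" "r < 1"
    using \<open>u < s\<close> by (auto simp: r_def)
  obtain m where m: "\<And>W. W \<in> F \<Longrightarrow> length W < m"
    by (metis F(1) finite_nat_set_iff_bounded finite_imageI image_eqI)
  have finW: "finite {W\<in>\<W>. length W = n}" for n
    by (rule finite_subset[OF _ finite_lists_length[of n]]) auto
  have "(\<Sum>W\<in>F. exp (- s * real (length W))) = (\<Sum>n\<in>length ` F. \<Sum>W\<in>{W\<in>F. length W = n}. exp (- s * real (length W)))"
    using F(1) by (rule sum.image_gen)
  also have "\<dots> \<le> (\<Sum>n\<in>length ` F. r ^ n)"
  proof (rule sum_mono)
    fix n assume n: "n \<in> length ` F"
    then have "n \<ge> N"
      using len F(2) by auto
    have "(\<Sum>W\<in>{W\<in>F. length W = n}. exp (- s * real (length W))) = real (card {W\<in>F. length W = n}) * exp (- s * real n)"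
      by simp
    also have "\<dots> \<le> exp (u * real n) * exp (- s * real n)"
    proof (rule mult_right_mono)
      have "card {W\<in>F. length W = n} \<le> card {W\<in>\<W>. length W = n}"
        using F(2) finW by (intro card_mono) auto
      then show "real (card {W\<in>F. length W = n}) \<le> exp (u * real n)"
        using card[OF \<open>n \<ge> N\<close>] by linarith
    qed simp
    also have "\<dots> = r ^ n"
      by (simp add: r_def algebra_simps flip: exp_add exp_of_nat_mult)
    finally show "(\<Sum>W\<in>{W\<in>F. length W = n}. exp (- s * real (length W))) \<le> r ^ n" .
  qed
  \<comment> \<open>All lengths occurring in \<open>F\<close> are at least \<open>N\<close> and
    below \<open>m\<close>, so this crude range contains them.\<close>
  also have "\<dots> \<le> (\<Sum>n\<in>{N..<N+m}. r ^ n)"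
    using r m len F by (intro sum_mono2) (fastforce)+
  also have "\<dots> = r ^ N * (\<Sum>n<m. r ^ n)"
    by (simp add: sum_distrib_left power_add sum.atLeastLessThan_shift_0[of _ N] atLeast0LessThan)
  also have "\<dots> \<le> r ^ N * (1 / (1 - r))"
    using r by (intro mult_left_mono) (auto simp: sum_gp_strict divide_right_mono)
  finally show "(\<Sum>W\<in>F. ennreal (exp (- s * real (length W)))) \<le> ennreal (exp (u - s) ^ N / (1 - exp (u - s)))"
    by (simp add: r_def sum_ennreal ennreal_leI)
qed

lemma geometric_tail_tendsto:
  assumes "u < (s::real)"
  shows "(\<lambda>N. exp (u - s) ^ N / (1 - exp (u - s))) \<longlonglongrightarrow> 0"
proof -
  have "(\<lambda>N. exp (u - s) ^ N / (1 - exp (u - s))) \<longlonglongrightarrow> 0 / (1 - exp (u - s))"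
    using assms by (intro tendsto_divide LIMSEQ_power_zero tendsto_const) auto
  then show ?thesis
    by simp
qed


section \<open>Null sets for Bowen and packing entropy\<close>

text \<open>Word lengths are not restricted: for \<open>t > 0\<close> a small total weight already
  forces every word to be long. Bowen nullity and Hausdorff nullity both reduce to this
  form.\<close>

definition cylinder_null :: "real \<Rightarrow> (nat \<Rightarrow> 'k) set \<Rightarrow> bool" where
  "cylinder_null t Z \<longleftrightarrow> (\<forall>e>0. \<exists>\<W>. Z \<subseteq> (\<Union>W\<in>\<W>. cylinder W) \<and>
     (\<Sum>\<^sub>\<infinity>W\<in>\<W>. ennreal (exp (- t * real (length W)))) \<le> ennreal e)"

text \<open>Fewer covers are admissible for larger \<open>N\<close>, so the premeasure is monotone
  in \<open>N\<close> and the \<open>lim\<close> in the definition is an actual limit.\<close>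

lemma bowen_measure_eq_SUP: "bowen_measure s Z = (SUP N. bowen_premeasure s N Z)"
  unfolding bowen_measure_def
proof (rule limI, rule LIMSEQ_SUP, rule incseq_SucI)
  show "bowen_premeasure s N Z \<le> bowen_premeasure s (Suc N) Z" for N
    unfolding bowen_premeasure_def by (rule INF_superset_mono) (auto simp: Suc_lessD)
qed

lemma packing_content_eq_INF: "packing_content s Z = (INF N. packing_premeasure s N Z)"
  unfolding packing_content_def
proof (rule limI, rule LIMSEQ_INF, rule decseq_SucI)
  show "packing_premeasure s (Suc N) Z \<le> packing_premeasure s N Z" for N
    unfolding packing_premeasure_def by (rule SUP_subset_mono) (auto simp: Suc_leD)
qed

lemma bowen_measure_eq_0_iff:
  fixes Z :: "(nat \<Rightarrow> 'k::finite) set"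
  assumes "t > 0"
  shows "bowen_measure t Z = 0 \<longleftrightarrow> cylinder_null t Z"
proof
  assume "bowen_measure t Z = 0"
  then have "bowen_premeasure t 0 Z = 0"
    by (metis SUP_upper UNIV_I bowen_measure_eq_SUP le_zero_eq)
  then have "bowen_premeasure t 0 Z < ennreal e" if "e > 0" for e
    using that by simp
  then show "cylinder_null t Z"
    unfolding cylinder_null_def bowen_premeasure_def INF_less_iff by (fastforce intro: less_imp_le)
next
  assume null: "cylinder_null t Z"
  have "bowen_premeasure t N Z = 0" for N
  proof (rule ennreal_eq_0_if_le_all)
    fix e :: real assume "e > 0"
    \<comment> \<open>The second bound keeps the weight of each single word at most that of a word
      of length \<open>N + 1\<close>, so every word of the cover is longer than
      \<open>N\<close>.\<close>
    define e' where "e' = min e (exp (- t * real (Suc N)))"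
    have "e' > 0"
      using \<open>e > 0\<close> by (simp add: e'_def)
    then obtain \<W> where \<W>: "Z \<subseteq> (\<Union>W\<in>\<W>. cylinder W)"
      "(\<Sum>\<^sub>\<infinity>W\<in>\<W>. ennreal (exp (- t * real (length W)))) \<le> ennreal e'"
      using null unfolding cylinder_null_def by blast
    have "length W > N" if "W \<in> \<W>" for W
    proof -
      have "ennreal (exp (- t * real (length W))) \<le> ennreal e'"
        using le_infsum_ennreal[OF that] \<W>(2) by (rule order_trans)
      then have "exp (- t * real (length W)) \<le> exp (- t * real (Suc N))"
        using \<open>e' > 0\<close> by (simp add: e'_def)
      then have "real (Suc N) \<le> real (length W)"
        using \<open>t > 0\<close> by simp
      then show ?thesis
        by linarith
    qed
    then have "bowen_premeasure t N Z \<le> (\<Sum>\<^sub>\<infinity>W\<in>\<W>. ennreal (exp (- t * real (length W))))"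
      unfolding bowen_premeasure_def using \<W>(1) by (intro INF_lower) auto
    also have "\<dots> \<le> ennreal e"
      using \<W>(2) by (rule order_trans) (simp add: e'_def ennreal_leI)
    finally show "bowen_premeasure t N Z \<le> ennreal e" .
  qed
  then show "bowen_measure t Z = 0"
    by (simp add: bowen_measure_eq_SUP)
qed

text \<open>With exponent 0 every word weighs 1, so a cover of a nonempty set weighs at least 1.
  This settles the exponent that \<open>bowen_measure_eq_0_iff\<close> leaves out.\<close>

lemma bowen_measure_0_imp_empty:
  assumes "bowen_measure 0 Z = 0"
  shows "Z = {}"
proof (rule ccontr)
  assume "Z \<noteq> {}"
  have "1 \<le> bowen_premeasure 0 0 Z"
    unfolding bowen_premeasure_def
  proof (rule INF_greatest, safe)
    fix \<W> :: "'a list set"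
    assume "Z \<subseteq> (\<Union>W\<in>\<W>. cylinder W)"
    then obtain W where "W \<in> \<W>"
      using \<open>Z \<noteq> {}\<close> by auto
    then show "1 \<le> (\<Sum>\<^sub>\<infinity>W\<in>\<W>. ennreal (exp (- 0 * real (length W))))"
      using le_infsum_ennreal[of W \<W> "\<lambda>_. 1"] by simp
  qed
  moreover have "bowen_premeasure 0 0 Z \<le> 0"
    unfolding assms[symmetric] bowen_measure_eq_SUP by (rule SUP_upper) simp
  ultimately show False
    by (metis dual_order.trans le_zero_eq zero_neq_one)
qed

lemma cylinder_null_empty: "cylinder_null t {}"
  by (auto simp: cylinder_null_def intro!: exI[of _ "{}"])

text \<open>A single prefix of a point of \<open>Y i\<close> is an admissible packing at every
  level, and at exponent 0 it weighs 1.\<close>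

lemma packing_measure_0_imp_empty:
  assumes "packing_measure 0 Z = 0"
  shows "Z = {}"
proof (rule ccontr)
  assume "Z \<noteq> {}"
  have "packing_measure 0 Z < 1"
    using assms by simp
  then obtain Y where Y: "Z \<subseteq> (\<Union>i. Y i)" "(\<Sum>i. packing_content 0 (Y i)) < 1"
    unfolding packing_measure_def INF_less_iff by blast
  then obtain i z where z: "z \<in> Y i"
    using \<open>Z \<noteq> {}\<close> by blast
  have "1 \<le> packing_content 0 (Y i)"
    unfolding packing_content_eq_INF
  proof (rule INF_greatest)
    fix N
    have "(\<Sum>\<^sub>\<infinity>W\<in>{pre z N}. ennreal (exp (- 0 * real (length W)))) \<le> packing_premeasure 0 N (Y i)"
      unfolding packing_premeasure_def
      using z by (intro SUP_upper) (auto simp: mem_cylinder_pre_iff disjoint_iff)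
    then show "1 \<le> packing_premeasure 0 N (Y i)"
      by simp
  qed
  with ennreal_suminf_lessD[OF Y(2), of i] show False
    by simp
qed

lemma packing_measure_empty: "packing_measure s ({} :: (nat \<Rightarrow> 'k::finite) set) = 0"
proof -
  have "packing_premeasure s N ({} :: (nat \<Rightarrow> 'k) set) = 0" for N
    unfolding packing_premeasure_def by (rule SUP_eq_const) auto
  then have "packing_content s ({} :: (nat \<Rightarrow> 'k) set) = 0"
    by (simp add: packing_content_eq_INF)
  then have "packing_measure s ({} :: (nat \<Rightarrow> 'k) set) \<le> (\<Sum>i::nat. 0)"
    unfolding packing_measure_def by (intro INF_lower2[of "\<lambda>_. {}"]) auto
  then show ?thesis
    by simp
qed

lemma exists_weight_less:
  assumes "t > 0" "e > (0::real)"
  obtains n :: nat where "exp (- t * real n) < e"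
proof -
  have "(\<lambda>n. exp (- t) ^ n) \<longlonglongrightarrow> 0"
    using assms by (intro LIMSEQ_power_zero) auto
  then have "eventually (\<lambda>n. exp (- t) ^ n < e) sequentially"
    using assms by (intro order_tendstoD)
  then obtain n where "exp (- t) ^ n < e"
    by (auto simp: eventually_sequentially)
  then show ?thesis
    by (intro that[of n]) (simp add: mult.commute flip: exp_of_nat_mult)
qed

text \<open>Entropy and dimension are compared at positive exponents; \<open>P0\<close> and
  \<open>Q0\<close> allow the exponent 0 to be dropped from both infima without changing them. The
  rest is the substitution of \<open>c * s\<close> for \<open>s\<close>.\<close>

lemma INF_ereal_critical_scale:
  fixes P Q :: "real \<Rightarrow> bool"
  assumes "c > 0" and PQ: "\<And>s. s > 0 \<Longrightarrow> P s \<longleftrightarrow> Q (c * s)"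
    and P0: "\<And>s. P 0 \<Longrightarrow> s > 0 \<Longrightarrow> P s" and Q0: "\<And>s. Q 0 \<Longrightarrow> s > 0 \<Longrightarrow> Q s"
  shows "(INF s\<in>{s. s \<ge> 0 \<and> Q s}. ereal s) = ereal c * (INF s\<in>{s. s \<ge> 0 \<and> P s}. ereal s)"
proof -
  have pos: "(INF s\<in>{s. s \<ge> 0 \<and> R s}. ereal s) = (INF s\<in>{s. s > 0 \<and> R s}. ereal s)"
    if R0: "\<And>s. R 0 \<Longrightarrow> s > 0 \<Longrightarrow> R s" for R
  proof (rule antisym)
    show "(INF s\<in>{s. s \<ge> 0 \<and> R s}. ereal s) \<le> (INF s\<in>{s. s > 0 \<and> R s}. ereal s)"
      by (rule INF_superset_mono) auto
    show "(INF s\<in>{s. s > 0 \<and> R s}. ereal s) \<le> (INF s\<in>{s. s \<ge> 0 \<and> R s}. ereal s)"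
    proof (rule INF_greatest, clarify)
      fix s :: real assume s: "s \<ge> 0" "R s"
      show "(INF s\<in>{s. s > 0 \<and> R s}. ereal s) \<le> ereal s"
      proof (rule ereal_le_epsilon2)
        fix e :: real assume "e > 0"
        \<comment> \<open>For \<open>s = 0\<close> the exponent \<open>e\<close> itself serves, by
          \<open>R0\<close>; otherwise \<open>s\<close> does.\<close>
        then have "\<exists>s'\<in>{s. s > 0 \<and> R s}. s' \<le> s + e"
          using s R0[of e] by (cases "s = 0") (auto intro: exI[of _ e] exI[of _ s])
        then obtain s' where "s' \<in> {s. s > 0 \<and> R s}" "s' \<le> s + e" ..
        then show "(INF s\<in>{s. s > 0 \<and> R s}. ereal s) \<le> ereal s + ereal e"
          by (intro INF_lower2[of s']) auto
      qed
    qed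
  qed
  have "{s. s > 0 \<and> Q s} = (*) c ` {s. s > 0 \<and> P s}"
  proof (intro equalityI subsetI)
    fix s assume s: "s \<in> {s. s > 0 \<and> Q s}"
    then have "s / c \<in> {s. s > 0 \<and> P s}"
      using PQ[of "s / c"] \<open>c > 0\<close> by simp
    then show "s \<in> (*) c ` {s. s > 0 \<and> P s}"
      using \<open>c > 0\<close> by (intro image_eqI[of _ _ "s / c"]) auto
  qed (use PQ \<open>c > 0\<close> in auto)
  then have "(INF s\<in>{s. s > 0 \<and> Q s}. ereal s) = (INF s\<in>{s. s > 0 \<and> P s}. ereal c * ereal s)"
    by (simp add: image_image)
  also have "\<dots> = ereal c * (INF s\<in>{s. s > 0 \<and> P s}. ereal s)"
    using ereal_Inf_cmult[OF \<open>c > 0\<close>, of "\<lambda>x. x \<in> ereal ` {s. s > 0 \<and> P s}"]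
    by (simp add: setcompr_eq_image image_image)
  finally show ?thesis
    using pos[of P] pos[of Q] P0 Q0 by simp
qed


section \<open>Dimensions with respect to the metric\<close>

lemma rho_cases:
  fixes x y :: "nat \<Rightarrow> 'k::finite"
  assumes "x \<noteq> y"
  obtains l where "rho x y = inverse (real CARD('k) ^ l)" "x l \<noteq> y l" "\<And>i. i < l \<Longrightarrow> x i = y i"
proof
  define l where "l = (LEAST n. x n \<noteq> y n)"
  show "rho x y = inverse (real CARD('k) ^ l)"
    using assms by (simp add: rho_def l_def)
  obtain k where "x k \<noteq> y k"
    using assms by blast
  then show "x l \<noteq> y l"
    unfolding l_def by (rule LeastI)
  show "x i = y i" if "i < l" for i
    using not_less_Least[of i "\<lambda>n. x n \<noteq> y n"] that by (auto simp: l_def)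
qed

lemma rho_le_1: "rho x y \<le> 1"
  by (simp add: rho_def inverse_le_1_iff Suc_leI)

lemma rho_nonneg: "0 \<le> rho x y"
  by (simp add: rho_def)

lemma mbounded_rho: "Metric_space.mbounded UNIV (rho :: (nat \<Rightarrow> 'k::finite) \<Rightarrow> _) U"
  by (auto simp: Metric_space.mbounded_def[OF Metric_space_rho] Metric_space.mcball_def[OF Metric_space_rho]
      intro!: exI[of _ 1] rho_le_1)

lemma rho_le_iff:
  fixes x y :: "nat \<Rightarrow> 'k::finite"
  assumes "CARD('k) \<ge> 2"
  shows "rho x y \<le> inverse (real CARD('k) ^ n) \<longleftrightarrow> (\<forall>i<n. x i = y i)"
proof (cases "x = y")
  case False
  then obtain l where l: "rho x y = inverse (real CARD('k) ^ l)" "x l \<noteq> y l" "\<And>i. i < l \<Longrightarrow> x i = y i"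
    using rho_cases by blast
  have "rho x y \<le> inverse (real CARD('k) ^ n) \<longleftrightarrow> real CARD('k) ^ n \<le> real CARD('k) ^ l"
    unfolding l(1) using assms by (intro inverse_le_iff_le) auto
  also have "\<dots> \<longleftrightarrow> n \<le> l"
    using assms by (intro power_increasing_iff) auto
  also have "\<dots> \<longleftrightarrow> (\<forall>i<n. x i = y i)"
    using l by (metis leI order_less_le_trans)
  finally show ?thesis .
qed (simp add: rho_def)

text \<open>The dictionary between the two settings: the cylinder weight at entropy exponent
  \<open>s * ln K\<close> is the \<open>s\<close>-th power of the scale of the cylinder.\<close>

lemma weight_eq_powr:
  assumes "K > 0"
  shows "exp (- (s * ln K * real n)) = inverse (K ^ n) powr s"
  using assms by (simp add: powr_def ln_inverse ln_realpow)

context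
  assumes K: "CARD('k::finite) \<ge> 2"
begin

abbreviation (input) "diam \<equiv> Metric_space.mdiameter (rho :: (nat \<Rightarrow> 'k) \<Rightarrow> _)"

lemma diam_upper:
  assumes "x \<in> U" "y \<in> U"
  shows "rho x y \<le> diam U"
proof -
  have "bdd_above ((\<lambda>(x, y). rho x y) ` (U \<times> U))"
    by (rule bdd_aboveI[of _ 1]) (auto simp: rho_le_1)
  then have "(\<lambda>(x, y). rho x y) (x, y) \<le> (SUP (x, y)\<in>U \<times> U. rho x y)"
    using assms by (intro cSUP_upper) auto
  then show ?thesis
    using assms by (auto simp: Metric_space.mdiameter_def[OF Metric_space_rho])
qed

lemma diam_cylinder_le: "diam (cylinder W) \<le> inverse (real CARD('k) ^ length W)"
proof -
  have "(SUP (x, y)\<in>cylinder W \<times> cylinder W. rho x y) \<le> inverse (real CARD('k) ^ length W)"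
    using cylinder_nonempty[of W] rho_le_iff[OF K, of _ _ "length W"]
    by (intro cSUP_least) (auto simp: cylinder_def)
  then show ?thesis
    using cylinder_nonempty[of W] by (simp add: Metric_space.mdiameter_def[OF Metric_space_rho])
qed

lemma diam_cylinder_nonneg: "diam (cylinder W) \<ge> 0"
proof -
  obtain x where "x \<in> cylinder W"
    using cylinder_nonempty[of W] by blast
  from diam_upper[OF this this] rho_nonneg[of x x] show ?thesis
    by linarith
qed

text \<open>Unless \<open>U\<close> is a single point, it lies in a smallest cylinder
  \<open>cylinder (pre x n)\<close>; then two points of \<open>U\<close> first differ at position
  \<open>n\<close>, which bounds the diameter from below by the scale of that cylinder. A single
  point has diameter 0 and lies in arbitrarily light cylinders, which is what the slack
  \<open>e\<close> is for.\<close>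

lemma exists_cylinder_weight_le:
  fixes U :: "(nat \<Rightarrow> 'k) set"
  assumes "U \<noteq> {}" "s > 0" "e > 0"
  obtains W where "U \<subseteq> cylinder W"
    "exp (- (s * ln (real CARD('k))) * real (length W)) \<le> diam U powr s + e"
proof -
  obtain x where x: "x \<in> U"
    using assms by blast
  show ?thesis
  proof (cases "\<forall>n. U \<subseteq> cylinder (pre x n)")
    case True
    have "s * ln (real CARD('k)) > 0"
      using K \<open>s > 0\<close> by simp
    then obtain n :: nat where "exp (- (s * ln (real CARD('k))) * real n) < e"
      using \<open>e > 0\<close> by (rule exists_weight_less)
    moreover have "diam U powr s \<ge> 0"
      by simp
    ultimately have "exp (- (s * ln (real CARD('k))) * real n) \<le> diam U powr s + e"
      by linarith
    with True show ?thesis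
      by (intro that[of "pre x n"]) auto
  next
    case False
    define m where "m = (LEAST m. \<not> U \<subseteq> cylinder (pre x m))"
    have m: "\<not> U \<subseteq> cylinder (pre x m)"
      using LeastI_ex[of "\<lambda>m. \<not> U \<subseteq> cylinder (pre x m)"] False by (simp add: m_def)
    then have "m \<noteq> 0"
      by (auto simp: mem_cylinder_pre_iff)
    then obtain n where n: "m = Suc n"
      using not0_implies_Suc by blast
    have Un: "U \<subseteq> cylinder (pre x n)"
      using not_less_Least[of n "\<lambda>m. \<not> U \<subseteq> cylinder (pre x m)"] n by (auto simp: m_def)
    obtain y where y: "y \<in> U" "y \<notin> cylinder (pre x m)"
      using m by blast
    have agree: "\<And>i. i < n \<Longrightarrow> x i = y i"
      using Un y(1) by (auto simp: mem_cylinder_pre_iff subset_iff)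
    then have "x n \<noteq> y n"
      using y(2) by (auto simp: mem_cylinder_pre_iff n less_Suc_eq)
    then have "x \<noteq> y"
      by auto
    then obtain l where l: "rho x y = inverse (real CARD('k) ^ l)" "x l \<noteq> y l" "\<And>i. i < l \<Longrightarrow> x i = y i"
      using rho_cases by blast
    have "l = n"
      using l agree \<open>x n \<noteq> y n\<close> by (metis linorder_neqE_nat)
    then have "inverse (real CARD('k) ^ n) \<le> diam U"
      using diam_upper[OF x y(1)] l(1) by simp
    then have "inverse (real CARD('k) ^ n) powr s \<le> diam U powr s"
      using \<open>s > 0\<close> by (intro powr_mono2) auto
    with \<open>e > 0\<close> Un show ?thesis
      by (intro that[of "pre x n"]) (auto simp: weight_eq_powr)
  qed
qed

lemma hausdorff_null_imp_cylinder_null: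
  fixes Z :: "(nat \<Rightarrow> 'k) set"
  assumes "s > 0" "Metric_space.hausdorff_outer_measure UNIV rho s Z = 0"
  shows "cylinder_null (s * ln (real CARD('k))) Z"
  unfolding cylinder_null_def
proof (intro allI impI)
  fix e :: real assume "e > 0"
  define t where "t = s * ln (real CARD('k))"
  have "Metric_space.hausdorff_premeasure UNIV rho s 1 Z \<le> Metric_space.hausdorff_outer_measure UNIV rho s Z"
    unfolding Metric_space.hausdorff_outer_measure_def[OF Metric_space_rho] by (rule SUP_upper) simp
  then have "Metric_space.hausdorff_premeasure UNIV rho s 1 Z < ennreal (e / 2)"
    using assms(2) \<open>e > 0\<close> by simp
  then obtain U :: "nat \<Rightarrow> (nat \<Rightarrow> 'k) set" where U: "Z \<subseteq> (\<Union>i. U i)"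
    "(\<Sum>i. Metric_space.hausdorff_gauge rho s (U i)) < ennreal (e / 2)"
    unfolding Metric_space.hausdorff_premeasure_def[OF Metric_space_rho] INF_less_iff by blast
  have "\<exists>W. U i \<subseteq> cylinder W \<and> exp (- t * real (length W)) \<le> diam (U i) powr s + e / 2 * (1/2) ^ Suc i"
    if "U i \<noteq> {}" for i
    unfolding t_def
    by (rule exists_cylinder_weight_le[OF that \<open>s > 0\<close>, of "e / 2 * (1/2) ^ Suc i"]) (use \<open>e > 0\<close> in auto)
  then obtain W where W: "\<And>i. U i \<noteq> {} \<Longrightarrow> U i \<subseteq> cylinder (W i)"
    "\<And>i. U i \<noteq> {} \<Longrightarrow> exp (- t * real (length (W i))) \<le> diam (U i) powr s + e / 2 * (1/2) ^ Suc i"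
    by metis
  \<comment> \<open>Empty members of the cover weigh 0 as sets, whereas every word has positive
    weight, so they must be dropped.\<close>
  define I where "I = {i. U i \<noteq> {}}"
  have "Z \<subseteq> (\<Union>V\<in>W ` I. cylinder V)"
  proof
    fix z assume "z \<in> Z"
    then obtain i where "z \<in> U i"
      using U(1) by blast
    then show "z \<in> (\<Union>V\<in>W ` I. cylinder V)"
      using W(1)[of i] by (auto simp: I_def)
  qed
  moreover have "(\<Sum>\<^sub>\<infinity>V\<in>W ` I. ennreal (exp (- t * real (length V)))) \<le> ennreal e"
  proof -
    have "(\<Sum>\<^sub>\<infinity>V\<in>W ` I. ennreal (exp (- t * real (length V))))
        \<le> infsum (\<lambda>i. Metric_space.hausdorff_gauge rho s (U i) + ennreal (e / 2 * (1/2) ^ Suc i)) UNIV"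
    \<comment> \<open>\<open>W\<close> may send several indices to the same word;
      \<open>inv_into\<close> keeps one index for each word.\<close>
    proof (rule infsum_le_infsum_ennreal_bij[where h = "inv_into I W"])
      show "inj_on (inv_into I W) (W ` I)"
        by (rule inj_on_inv_into) simp
      fix V assume V: "V \<in> W ` I"
      define i where "i = inv_into I W V"
      have i: "i \<in> I" "W i = V"
        using V by (simp_all add: i_def inv_into_into f_inv_into_f)
      have "ennreal (exp (- t * real (length V))) \<le> ennreal (diam (U i) powr s + e / 2 * (1/2) ^ Suc i)"
        using W(2)[of i] i by (intro ennreal_leI) (auto simp: I_def)
      also have "\<dots> = ennreal (diam (U i) powr s) + ennreal (e / 2 * (1/2) ^ Suc i)"
        using \<open>e > 0\<close> by (intro ennreal_plus) auto
      also have "ennreal (diam (U i) powr s) = Metric_space.hausdorff_gauge rho s (U i)"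
        using i \<open>s > 0\<close> by (simp add: Metric_space.hausdorff_gauge_def[OF Metric_space_rho] I_def)
      finally show "ennreal (exp (- t * real (length V))) \<le> Metric_space.hausdorff_gauge rho s (U (inv_into I W V)) + ennreal (e / 2 * (1/2) ^ Suc (inv_into I W V))"
        by (simp add: i_def)
    qed simp
    also have "\<dots> = (\<Sum>i. Metric_space.hausdorff_gauge rho s (U i)) + (\<Sum>i. ennreal (e / 2 * (1/2) ^ Suc i))"
      unfolding suminf_eq_infsum_ennreal[symmetric] by (rule suminf_add[symmetric]) auto
    also have "(\<Sum>i. ennreal (e / 2 * (1/2) ^ Suc i)) = ennreal (e / 2)"
      using \<open>e > 0\<close> by (intro suminf_halves_ennreal) simp
    also have "(\<Sum>i. Metric_space.hausdorff_gauge rho s (U i)) + ennreal (e / 2) \<le> ennreal (e / 2) + ennreal (e / 2)"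
      using U(2) by (intro add_right_mono) (rule less_imp_le)
    also have "\<dots> = ennreal e"
      using \<open>e > 0\<close> by (simp flip: ennreal_plus)
    finally show ?thesis .
  qed
  ultimately show "\<exists>\<W>. Z \<subseteq> (\<Union>W\<in>\<W>. cylinder W) \<and>
      (\<Sum>\<^sub>\<infinity>W\<in>\<W>. ennreal (exp (- (s * ln (real CARD('k))) * real (length W)))) \<le> ennreal e"
    unfolding t_def by blast
qed

lemma cylinder_null_imp_hausdorff_null:
  fixes Z :: "(nat \<Rightarrow> 'k) set"
  assumes "s > 0" "cylinder_null (s * ln (real CARD('k))) Z"
  shows "Metric_space.hausdorff_outer_measure UNIV rho s Z = 0"
proof -
  define t where "t = s * ln (real CARD('k))"
  have "Metric_space.hausdorff_premeasure UNIV rho s \<delta> Z = 0" if "\<delta> > 0" for \<delta>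
  proof (rule ennreal_eq_0_if_le_all)
    fix e :: real assume "e > 0"
    \<comment> \<open>A weight of at most \<open>\<delta> powr s\<close> forces the scale of each
      cylinder, hence its diameter, to be at most \<open>\<delta>\<close>.\<close>
    define e' where "e' = min e (\<delta> powr s)"
    have "e' > 0"
      using \<open>e > 0\<close> \<open>\<delta> > 0\<close> by (simp add: e'_def)
    then obtain \<W> where \<W>: "Z \<subseteq> (\<Union>W\<in>\<W>. cylinder W)"
      "(\<Sum>\<^sub>\<infinity>W\<in>\<W>. ennreal (exp (- t * real (length W)))) \<le> ennreal e'"
      using assms(2) unfolding cylinder_null_def t_def by blast
    \<comment> \<open>The words are numbered by \<open>to_nat\<close>; the remaining numbers get the
      empty set, whose gauge is 0.\<close>
    define U :: "nat \<Rightarrow> (nat \<Rightarrow> 'k) set" where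
      "U i = (if i \<in> to_nat ` \<W> then cylinder (from_nat i) else {})" for i
    have gauge: "Metric_space.hausdorff_gauge rho s (cylinder W) \<le> ennreal (exp (- t * real (length W)))"
      for W :: "'k list"
    proof -
      have "diam (cylinder W) powr s \<le> inverse (real CARD('k) ^ length W) powr s"
        using \<open>s > 0\<close> diam_cylinder_le diam_cylinder_nonneg by (intro powr_mono2) auto
      then show ?thesis
        using \<open>s > 0\<close> cylinder_nonempty[of W]
        by (simp add: Metric_space.hausdorff_gauge_def[OF Metric_space_rho] weight_eq_powr t_def ennreal_leI)
    qed
    have diam: "diam (cylinder W) \<le> \<delta>" if "W \<in> \<W>" for W
    proof -
      have "ennreal (exp (- t * real (length W))) \<le> ennreal e'"
        using le_infsum_ennreal[OF that] \<W>(2) by (rule order_trans)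
      then have "exp (- t * real (length W)) \<le> \<delta> powr s"
        using \<open>e' > 0\<close> by (simp add: e'_def)
      then have "inverse (real CARD('k) ^ length W) powr s \<le> \<delta> powr s"
        by (simp add: t_def weight_eq_powr)
      then have "inverse (real CARD('k) ^ length W) \<le> \<delta>"
        using \<open>s > 0\<close> \<open>\<delta> > 0\<close> powr_less_mono2[of s \<delta> "inverse (real CARD('k) ^ length W)"]
        by (meson less_imp_le not_less)
      then show ?thesis
        using diam_cylinder_le[of W] by linarith
    qed
    have "Metric_space.hausdorff_premeasure UNIV rho s \<delta> Z \<le> (\<Sum>i. Metric_space.hausdorff_gauge rho s (U i))"
      unfolding Metric_space.hausdorff_premeasure_def[OF Metric_space_rho]
    proof (intro INF_lower CollectI conjI allI)
      show "Z \<subseteq> (\<Union>i. U i)"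
        using \<W>(1) by (fastforce simp: U_def)
      show "diam (U i) \<le> \<delta>" for i
        using diam \<open>\<delta> > 0\<close> by (auto simp: U_def Metric_space.mdiameter_def[OF Metric_space_rho, of "{}"])
    qed (rule mbounded_rho)
    also have "\<dots> = infsum (\<lambda>i. Metric_space.hausdorff_gauge rho s (U i)) (to_nat ` \<W>)"
      unfolding suminf_eq_infsum_ennreal
      by (rule infsum_cong_neutral) (auto simp: U_def Metric_space.hausdorff_gauge_def[OF Metric_space_rho])
    also have "\<dots> \<le> (\<Sum>\<^sub>\<infinity>W\<in>\<W>. ennreal (exp (- t * real (length W))))"
      by (rule infsum_le_infsum_ennreal_bij[where h = from_nat]) (auto simp: U_def gauge[simplified] inj_on_def)
    also have "\<dots> \<le> ennreal e"
      using \<W>(2) by (rule order_trans) (simp add: e'_def ennreal_leI)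
    finally show "Metric_space.hausdorff_premeasure UNIV rho s \<delta> Z \<le> ennreal e" .
  qed
  then show ?thesis
    by (simp add: Metric_space.hausdorff_outer_measure_def[OF Metric_space_rho])
qed

lemma hausdorff_outer_measure_0_imp_empty:
  fixes Z :: "(nat \<Rightarrow> 'k) set"
  assumes "Metric_space.hausdorff_outer_measure UNIV rho 0 Z = 0"
  shows "Z = {}"
proof (rule ccontr)
  assume "Z \<noteq> {}"
  have "Metric_space.hausdorff_premeasure UNIV rho 0 1 Z \<le> Metric_space.hausdorff_outer_measure UNIV rho 0 Z"
    unfolding Metric_space.hausdorff_outer_measure_def[OF Metric_space_rho] by (rule SUP_upper) simp
  then have "Metric_space.hausdorff_premeasure UNIV rho 0 1 Z < 1"
    using assms by simp
  then obtain U :: "nat \<Rightarrow> (nat \<Rightarrow> 'k) set" where U: "Z \<subseteq> (\<Union>i. U i)"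
    "(\<Sum>i. Metric_space.hausdorff_gauge rho 0 (U i)) < 1"
    unfolding Metric_space.hausdorff_premeasure_def[OF Metric_space_rho] INF_less_iff by blast
  obtain i where "U i \<noteq> {}"
    using U(1) \<open>Z \<noteq> {}\<close> by blast
  then have "Metric_space.hausdorff_gauge rho 0 (U i) = 1"
    by (simp add: Metric_space.hausdorff_gauge_def[OF Metric_space_rho])
  with ennreal_suminf_lessD[OF U(2), of i] show False
    by simp
qed

lemma bowen_entropy_eq_hausdorff_dim:
  fixes Z :: "(nat \<Rightarrow> 'k) set"
  shows "bowen_entropy Z = ereal (ln (real CARD('k))) * Metric_space.hausdorff_dim UNIV rho Z"
  unfolding bowen_entropy_def Metric_space.hausdorff_dim_def[OF Metric_space_rho]
proof (rule INF_ereal_critical_scale)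
  have lnK: "ln (real CARD('k)) > 0"
    using K by simp
  then show "0 < ln (real CARD('k))" .
  have iff: "Metric_space.hausdorff_outer_measure UNIV rho s Y = 0 \<longleftrightarrow> cylinder_null (s * ln (real CARD('k))) Y"
    if "s > 0" for s and Y :: "(nat \<Rightarrow> 'k) set"
    using hausdorff_null_imp_cylinder_null cylinder_null_imp_hausdorff_null that by blast
  show "Metric_space.hausdorff_outer_measure UNIV rho s Z = 0 \<longleftrightarrow> bowen_measure (ln (real CARD('k)) * s) Z = 0"
    if "s > 0" for s
    using that lnK by (simp add: iff bowen_measure_eq_0_iff mult.commute)
  show "Metric_space.hausdorff_outer_measure UNIV rho s Z = 0"
    if "Metric_space.hausdorff_outer_measure UNIV rho 0 Z = 0" "s > 0" for s
    using hausdorff_outer_measure_0_imp_empty[OF that(1)] that(2) by (simp add: iff cylinder_null_empty)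
  show "bowen_measure s Z = 0" if "bowen_measure 0 Z = 0" "s > 0" for s
    using bowen_measure_0_imp_empty[OF that(1)] that(2) by (simp add: bowen_measure_eq_0_iff cylinder_null_empty)
qed


text \<open>The metric takes only the values 0 and powers of \<open>1 / K\<close>, so the ball
  depends on \<open>r\<close> only through the first such power not exceeding \<open>r\<close>.
  Rounding down loses at most a factor \<open>K\<close>; for \<open>n = 0\<close> this bound rests
  on \<open>r \<le> 1\<close>.\<close>

lemma mcball_eq_cylinder:
  fixes x :: "nat \<Rightarrow> 'k"
  assumes "0 < r" "r \<le> 1"
  obtains n where "Metric_space.mcball UNIV rho x r = cylinder (pre x n)"
    "inverse (real CARD('k) ^ n) \<le> r" "r \<le> real CARD('k) * inverse (real CARD('k) ^ n)"
proof -
  define n where "n = (LEAST n. inverse (real CARD('k) ^ n) \<le> r)"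
  have "\<exists>n. inverse (real CARD('k) ^ n) \<le> r"
  proof -
    have "(\<lambda>n. inverse (real CARD('k)) ^ n) \<longlonglongrightarrow> 0"
      using K by (intro LIMSEQ_power_zero) (auto simp: inverse_less_1_iff)
    then have "eventually (\<lambda>n. inverse (real CARD('k)) ^ n < r) sequentially"
      using \<open>0 < r\<close> by (intro order_tendstoD)
    then show ?thesis
      by (auto simp: eventually_sequentially power_inverse intro: less_imp_le)
  qed
  then have n: "inverse (real CARD('k) ^ n) \<le> r"
    unfolding n_def by (rule LeastI_ex)
  have least: "r < inverse (real CARD('k) ^ m)" if "m < n" for m
    using not_less_Least[of m "\<lambda>n. inverse (real CARD('k) ^ n) \<le> r"] that by (simp add: n_def)
  have "rho x y \<le> r \<longleftrightarrow> (\<forall>i<n. x i = y i)" for y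
  proof
    assume r: "rho x y \<le> r"
    show "\<forall>i<n. x i = y i"
    proof (cases "x = y")
      case False
      then obtain l where l: "rho x y = inverse (real CARD('k) ^ l)" "x l \<noteq> y l" "\<And>i. i < l \<Longrightarrow> x i = y i"
        using rho_cases by blast
      then have "n \<le> l"
        using r least[of l] by (cases "l < n") auto
      with l(3) show ?thesis
        by auto
    qed simp
  next
    assume "\<forall>i<n. x i = y i"
    then show "rho x y \<le> r"
      using rho_le_iff[OF K, of x y n] n by auto
  qed
  then have "Metric_space.mcball UNIV rho x r = cylinder (pre x n)"
    by (auto simp: Metric_space.mcball_def[OF Metric_space_rho] mem_cylinder_pre_iff eq_commute)
  moreover have "r \<le> real CARD('k) * inverse (real CARD('k) ^ n)"
  proof (cases n)
    case 0
    then show ?thesis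
      using \<open>r \<le> 1\<close> K by simp
  next
    case (Suc m)
    then show ?thesis
      using least[of m] K by (simp add: field_simps)
  qed
  ultimately show ?thesis
    using n that by blast
qed

text \<open>Each ball is the cylinder of a prefix of its centre. The factor
  \<open>(2 * K) powr s\<close> pays for counting a ball by twice its radius and for rounding the
  radius down to a power of \<open>1 / K\<close>.\<close>

lemma ball_packing_premeasure_le:
  fixes Z :: "(nat \<Rightarrow> 'k) set"
  assumes "s \<ge> 0"
  shows "ennreal (inverse ((2 * real CARD('k)) powr s)) *
      Metric_space.ball_packing_premeasure UNIV rho s (inverse (real CARD('k) ^ N)) Z
    \<le> packing_premeasure (s * ln (real CARD('k))) N Z"
proof -
  define c where "c = inverse ((2 * real CARD('k)) powr s)"
  define t where "t = s * ln (real CARD('k))"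
  have "ennreal c * (\<Sum>\<^sub>\<infinity>(x, r)\<in>C. ennreal ((2 * r) powr s)) \<le> packing_premeasure t N Z"
    if C: "Metric_space.ball_packing UNIV rho (inverse (real CARD('k) ^ N)) Z C" for C
  proof -
    have C': "x \<in> Z" "0 < r" "r \<le> inverse (real CARD('k) ^ N)" if "(x, r) \<in> C" for x r
      using C that unfolding Metric_space.ball_packing_def[OF Metric_space_rho] by auto
    have "inverse (real CARD('k) ^ N) \<le> 1"
      by (simp add: inverse_le_1_iff Suc_leI)
    then have "\<exists>n. Metric_space.mcball UNIV rho x r = cylinder (pre x n) \<and>
      inverse (real CARD('k) ^ n) \<le> r \<and> r \<le> real CARD('k) * inverse (real CARD('k) ^ n)"
      if "(x, r) \<in> C" for x r
    proof -
      have "0 < r" "r \<le> 1"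
        using C'[OF that] \<open>inverse (real CARD('k) ^ N) \<le> 1\<close> by linarith+
      then show ?thesis
        by (rule mcball_eq_cylinder[of r x]) blast
    qed
    then obtain n where n: "\<And>x r. (x, r) \<in> C \<Longrightarrow> Metric_space.mcball UNIV rho x r = cylinder (pre x (n x r))"
      "\<And>x r. (x, r) \<in> C \<Longrightarrow> inverse (real CARD('k) ^ n x r) \<le> r"
      "\<And>x r. (x, r) \<in> C \<Longrightarrow> r \<le> real CARD('k) * inverse (real CARD('k) ^ n x r)"
      by metis
    define w where "w = (\<lambda>(x, r). pre x (n x r))"
    have disj: "disjnt (cylinder (w p)) (cylinder (w q))" if "p \<in> C" "q \<in> C" "p \<noteq> q" for p q
      using C that n(1) unfolding Metric_space.ball_packing_def[OF Metric_space_rho] pairwise_def w_def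
      by (cases p; cases q) force
    have "ennreal c * (\<Sum>\<^sub>\<infinity>(x, r)\<in>C. ennreal ((2 * r) powr s)) =
        (\<Sum>\<^sub>\<infinity>p\<in>C. ennreal c * (case p of (x, r) \<Rightarrow> ennreal ((2 * r) powr s)))"
      by (rule infsum_cmult_ennreal[symmetric])
    also have "\<dots> \<le> (\<Sum>\<^sub>\<infinity>W\<in>w ` C. ennreal (exp (- t * real (length W))))"
    proof (rule infsum_le_infsum_ennreal_bij[where h = w])
      show "inj_on w C"
        using disj cylinder_nonempty by (metis disjnt_self_iff_empty inj_onI)
      show "ennreal c * (case p of (x, r) \<Rightarrow> ennreal ((2 * r) powr s)) \<le> ennreal (exp (- t * real (length (w p))))"
        if "p \<in> C" for p
      proof -
        obtain x r where p: "p = (x, r)"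
          by fastforce
        have xr: "(x, r) \<in> C"
          using that p by simp
        have "(2 * r) powr s \<le> (2 * real CARD('k) * inverse (real CARD('k) ^ n x r)) powr s"
          using n(3)[OF xr] C'(2)[OF xr] \<open>s \<ge> 0\<close> by (intro powr_mono2) auto
        also have "\<dots> = (2 * real CARD('k)) powr s * inverse (real CARD('k) ^ n x r) powr s"
          by (rule powr_mult)
        finally have "c * (2 * r) powr s \<le> c * ((2 * real CARD('k)) powr s * inverse (real CARD('k) ^ n x r) powr s)"
          by (intro mult_left_mono) (simp_all add: c_def)
        also have "\<dots> = inverse (real CARD('k) ^ n x r) powr s"
          by (simp add: c_def)
        also have "\<dots> = exp (- t * real (length (w p)))"
          by (simp add: t_def weight_eq_powr w_def p)
        finally have "ennreal (c * (2 * r) powr s) \<le> ennreal (exp (- t * real (length (w p))))"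
          by (rule ennreal_leI)
        then show ?thesis
          by (simp add: p ennreal_mult c_def)
      qed
    qed simp
    also have "\<dots> \<le> packing_premeasure t N Z"
      unfolding packing_premeasure_def
    proof (rule SUP_upper, rule CollectI, intro conjI ballI)
      show "pairwise (\<lambda>V W. disjnt (cylinder V) (cylinder W)) (w ` C)"
        using disj by (auto simp: pairwise_def)
      fix W assume "W \<in> w ` C"
      then obtain x r where xr: "(x, r) \<in> C" "W = pre x (n x r)"
        by (auto simp: w_def)
      then have "x \<in> cylinder W \<inter> Z"
        using C'(1) by (auto simp: mem_cylinder_pre_iff)
      then show "cylinder W \<inter> Z \<noteq> {}"
        by blast
      have "inverse (real CARD('k) ^ n x r) \<le> inverse (real CARD('k) ^ N)"
        using n(2)[OF xr(1)] C'(3)[OF xr(1)] by linarith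
      then have "real CARD('k) ^ N \<le> real CARD('k) ^ n x r"
        using K by (subst (asm) inverse_le_iff_le) auto
      then have "N \<le> n x r"
        using K by (subst (asm) power_increasing_iff) auto
      then show "N \<le> length W"
        by (simp add: xr)
    qed
    finally show ?thesis .
  qed
  then show ?thesis
    unfolding Metric_space.ball_packing_premeasure_def[OF Metric_space_rho] SUP_mult_left_ennreal
    by (intro SUP_least) (simp add: c_def t_def)
qed

text \<open>Every cylinder of a packing is a closed ball around a point that it shares with
  \<open>Z\<close>, with its own scale as radius. Counting the ball by twice this radius produces
  exactly the factor \<open>2 powr s\<close>.\<close>

lemma packing_premeasure_le:
  fixes Z :: "(nat \<Rightarrow> 'k) set"
  assumes "inverse (real CARD('k) ^ N) \<le> \<delta>"
  shows "ennreal (2 powr s) * packing_premeasure (s * ln (real CARD('k))) N Z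
    \<le> Metric_space.ball_packing_premeasure UNIV rho s \<delta> Z"
proof -
  define t where "t = s * ln (real CARD('k))"
  have "ennreal (2 powr s) * (\<Sum>\<^sub>\<infinity>W\<in>\<W>. ennreal (exp (- t * real (length W))))
      \<le> Metric_space.ball_packing_premeasure UNIV rho s \<delta> Z"
    if \<W>: "pairwise (\<lambda>V W. disjnt (cylinder V) (cylinder W)) \<W>"
      "\<forall>W\<in>\<W>. cylinder W \<inter> Z \<noteq> {} \<and> N \<le> length W" for \<W> :: "'k list set"
  proof -
    define x where "x W = (SOME x. x \<in> cylinder W \<inter> Z)" for W
    have "x W \<in> cylinder W \<inter> Z" if "W \<in> \<W>" for W
      using some_in_eq[of "cylinder W \<inter> Z"] \<W>(2) that by (auto simp only: x_def)
    then have x: "\<And>W. W \<in> \<W> \<Longrightarrow> x W \<in> cylinder W" "\<And>W. W \<in> \<W> \<Longrightarrow> x W \<in> Z"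
      by auto
    define b where "b W = (x W, inverse (real CARD('k) ^ length W))" for W
    have ball: "Metric_space.mcball UNIV rho (x W) (inverse (real CARD('k) ^ length W)) = cylinder W"
      if "W \<in> \<W>" for W
      using x(1)[OF that] rho_le_iff[OF K, of "x W" _ "length W"]
      by (auto simp: Metric_space.mcball_def[OF Metric_space_rho] cylinder_def)
    have disj: "disjnt (cylinder V) (cylinder W)" if "V \<in> \<W>" "W \<in> \<W>" "V \<noteq> W" for V W
      using \<W>(1) that by (auto simp: pairwise_def)
    have "ennreal (2 powr s) * (\<Sum>\<^sub>\<infinity>W\<in>\<W>. ennreal (exp (- t * real (length W)))) =
        (\<Sum>\<^sub>\<infinity>W\<in>\<W>. ennreal (2 powr s) * ennreal (exp (- t * real (length W))))"
      by (rule infsum_cmult_ennreal[symmetric])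
    also have "\<dots> \<le> (\<Sum>\<^sub>\<infinity>(x, r)\<in>b ` \<W>. ennreal ((2 * r) powr s))"
    proof (rule infsum_le_infsum_ennreal_bij[where h = b])
      show "inj_on b \<W>"
      proof (rule inj_onI, rule ccontr)
        fix V W assume VW: "V \<in> \<W>" "W \<in> \<W>" "b V = b W" "V \<noteq> W"
        then have "x V \<in> cylinder V" "x V \<in> cylinder W"
          using x(1)[of V] x(1)[of W] by (auto simp: b_def)
        with disj[OF VW(1,2,4)] show False
          by (auto simp: disjnt_iff)
      qed
      show "ennreal (2 powr s) * ennreal (exp (- t * real (length W))) \<le> (case b W of (x, r) \<Rightarrow> ennreal ((2 * r) powr s))"
        for W
        by (simp add: b_def t_def weight_eq_powr powr_mult del: inverse_eq_divide flip: ennreal_mult')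
    qed simp
    also have "\<dots> \<le> Metric_space.ball_packing_premeasure UNIV rho s \<delta> Z"
      unfolding Metric_space.ball_packing_premeasure_def[OF Metric_space_rho]
    proof (rule SUP_upper, rule CollectI)
      have small: "inverse (real CARD('k) ^ length W) \<le> \<delta>" if "W \<in> \<W>" for W
      proof -
        have "inverse (real CARD('k) ^ length W) \<le> inverse (real CARD('k) ^ N)"
          using \<W>(2) that K by (intro le_imp_inverse_le power_increasing) auto
        with assms show ?thesis
          by linarith
      qed
      have "pairwise (\<lambda>(x, r) (y, t). disjnt (Metric_space.mcball UNIV rho x r) (Metric_space.mcball UNIV rho y t)) (b ` \<W>)"
        using disj by (auto simp: pairwise_def b_def ball)
      moreover have "\<forall>(x, r)\<in>b ` \<W>. x \<in> Z \<and> 0 < r \<and> r \<le> \<delta>"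
        using x(2) small by (auto simp: b_def)
      ultimately show "Metric_space.ball_packing UNIV rho \<delta> Z (b ` \<W>)"
        unfolding Metric_space.ball_packing_def[OF Metric_space_rho] by simp
    qed
    finally show ?thesis .
  qed
  then show ?thesis
    unfolding packing_premeasure_def SUP_mult_left_ennreal
    by (intro SUP_least) (simp add: t_def)
qed

lemma ball_packing_content_le:
  fixes Z :: "(nat \<Rightarrow> 'k) set"
  assumes "s \<ge> 0"
  shows "ennreal (inverse ((2 * real CARD('k)) powr s)) * Metric_space.ball_packing_content UNIV rho s Z
    \<le> packing_content (s * ln (real CARD('k))) Z"
  unfolding packing_content_eq_INF
proof (rule INF_greatest)
  fix N
  have "Metric_space.ball_packing_content UNIV rho s Z
      \<le> Metric_space.ball_packing_premeasure UNIV rho s (inverse (real CARD('k) ^ N)) Z"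
    unfolding Metric_space.ball_packing_content_def[OF Metric_space_rho] by (rule INF_lower) simp
  then show "ennreal (inverse ((2 * real CARD('k)) powr s)) * Metric_space.ball_packing_content UNIV rho s Z
      \<le> packing_premeasure (s * ln (real CARD('k))) N Z"
    using ball_packing_premeasure_le[OF assms, of N Z] by (meson mult_left_mono order_trans zero_le)
qed

lemma packing_content_le:
  fixes Z :: "(nat \<Rightarrow> 'k) set"
  shows "ennreal (2 powr s) * packing_content (s * ln (real CARD('k))) Z
    \<le> Metric_space.ball_packing_content UNIV rho s Z"
  unfolding Metric_space.ball_packing_content_def[OF Metric_space_rho]
proof (rule INF_greatest)
  fix \<delta> :: real assume "\<delta> \<in> {0<..}"
  then obtain n where n: "inverse (real CARD('k) ^ n) \<le> min \<delta> 1"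
    using mcball_eq_cylinder[of "min \<delta> 1"] by (metis greaterThan_iff min.cobounded2 min_less_iff_conj zero_less_one)
  have "packing_content (s * ln (real CARD('k))) Z \<le> packing_premeasure (s * ln (real CARD('k))) n Z"
    unfolding packing_content_eq_INF by (rule INF_lower) simp
  moreover have "inverse (real CARD('k) ^ n) \<le> \<delta>"
    using n by simp
  ultimately show "ennreal (2 powr s) * packing_content (s * ln (real CARD('k))) Z
      \<le> Metric_space.ball_packing_premeasure UNIV rho s \<delta> Z"
    using packing_premeasure_le[of n \<delta> s Z] by (meson mult_left_mono order_trans zero_le)
qed

lemma packing_measure_eq_0_iff:
  fixes Z :: "(nat \<Rightarrow> 'k) set"
  assumes "s \<ge> 0"
  shows "packing_measure (s * ln (real CARD('k))) Z = 0 \<longleftrightarrow>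
    Metric_space.ball_packing_outer_measure UNIV rho s Z = 0"
proof -
  \<comment> \<open>Vanishing of the measure is insensitive to a constant factor in the contents, so
    two one-sided comparisons suffice.\<close>
  have cmp: "(INF Y\<in>\<Y>. \<Sum>i. g (Y i)) = 0"
    if "(INF Y\<in>\<Y>. \<Sum>i. f (Y i)) = 0" "c > 0" "\<And>Y. ennreal c * g Y \<le> f Y"
    for f g :: "(nat \<Rightarrow> 'k) set \<Rightarrow> ennreal" and c and \<Y> :: "(nat \<Rightarrow> (nat \<Rightarrow> 'k) set) set"
  proof -
    have "ennreal c * (INF Y\<in>\<Y>. \<Sum>i. g (Y i)) \<le> (INF Y\<in>\<Y>. \<Sum>i. f (Y i))"
    proof (rule INF_greatest)
      fix Y assume "Y \<in> \<Y>"
      then have "ennreal c * (INF Y\<in>\<Y>. \<Sum>i. g (Y i)) \<le> ennreal c * (\<Sum>i. g (Y i))"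
        by (intro mult_left_mono INF_lower) auto
      also have "\<dots> = (\<Sum>i. ennreal c * g (Y i))"
        by simp
      also have "\<dots> \<le> (\<Sum>i. f (Y i))"
        using that(3) by (intro suminf_le summableI)
      finally show "ennreal c * (INF Y\<in>\<Y>. \<Sum>i. g (Y i)) \<le> (\<Sum>i. f (Y i))" .
    qed
    with that(1,2) show ?thesis
      by auto
  qed
  show ?thesis
    unfolding packing_measure_def Metric_space.ball_packing_outer_measure_def[OF Metric_space_rho]
    using cmp[OF _ _ packing_content_le[of s]] cmp[OF _ _ ball_packing_content_le[OF assms]]
    by (auto simp: K)
qed

lemma packing_entropy_eq_packing_dim:
  fixes Z :: "(nat \<Rightarrow> 'k) set"
  shows "packing_entropy Z = ereal (ln (real CARD('k))) * Metric_space.packing_dim UNIV rho Z"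
  unfolding packing_entropy_def Metric_space.packing_dim_def[OF Metric_space_rho]
proof (rule INF_ereal_critical_scale)
  show "0 < ln (real CARD('k))"
    using K by simp
  have iff: "Metric_space.ball_packing_outer_measure UNIV rho s Z = 0 \<longleftrightarrow>
      packing_measure (ln (real CARD('k)) * s) Z = 0" if "s \<ge> 0" for s
    using packing_measure_eq_0_iff[OF that, of Z] by (simp add: mult.commute)
  show "Metric_space.ball_packing_outer_measure UNIV rho s Z = 0 \<longleftrightarrow>
      packing_measure (ln (real CARD('k)) * s) Z = 0" if "s > 0" for s
    using that by (simp add: iff)
  show "Metric_space.ball_packing_outer_measure UNIV rho s Z = 0"
    if "Metric_space.ball_packing_outer_measure UNIV rho 0 Z = 0" "s > 0" for s
    using packing_measure_0_imp_empty[of Z] packing_measure_empty that iff[of 0] iff[of s] by simp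
  show "packing_measure s Z = 0" if "packing_measure 0 Z = 0" for s
    using packing_measure_0_imp_empty[OF that] packing_measure_empty by simp
qed

end


section \<open>Growth of the language of a subshift\<close>

text \<open>The topological and packing entropies of the theorem, and the Bowen entropy of the
  subshift itself, are all identified with this number.\<close>

definition growth :: "(nat \<Rightarrow> 'k) set \<Rightarrow> ereal" where
  "growth X = limsup (\<lambda>n. ereal (ln (real (card (words X n))) / real n))"

lemma ereal_le_if_all_real_above:
  fixes x g :: ereal
  assumes "\<And>s. g < ereal s \<Longrightarrow> x \<le> ereal s"
  shows "x \<le> g"
proof (rule ccontr)
  assume "\<not> x \<le> g"
  then have "g < x"
    by simp
  then obtain s where "g < ereal s" "ereal s < x"
    using ereal_dense2 by blast
  with assms[of s] show False
    by simp
qed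

text \<open>Lengthening words by \<open>m\<close> letters multiplies their number by a factor
  independent of \<open>n\<close>, which vanishes in the growth rate. This makes the resolution
  \<open>\<epsilon>\<close> in the topological entropy harmless.\<close>

lemma card_words_add_le:
  fixes X :: "(nat \<Rightarrow> 'k::finite) set"
  shows "card (words X (n + m)) \<le> card (words X n) * CARD('k) ^ m"
proof -
  have "words X (n + m) \<subseteq> (\<lambda>(U, V). U @ V) ` (words X n \<times> {V. length V = m})"
  proof
    fix W assume "W \<in> words X (n + m)"
    then obtain x where x: "x \<in> X" "W = pre x (n + m)"
      by (auto simp: words_def)
    then show "W \<in> (\<lambda>(U, V). U @ V) ` (words X n \<times> {V. length V = m})"
      by (intro image_eqI[of _ _ "(pre x n, pre (\<lambda>i. x (n + i)) m)"]) (auto simp: pre_add words_def)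
  qed
  then have "card (words X (n + m)) \<le> card ((\<lambda>(U, V). U @ V) ` (words X n \<times> {V. length V = m}))"
    by (intro card_mono finite_imageI finite_cartesian_product finite_words finite_lists_length)
  also have "\<dots> \<le> card (words X n \<times> {V :: 'k list. length V = m})"
    by (intro card_image_le finite_cartesian_product finite_words finite_lists_length)
  also have "\<dots> = card (words X n) * CARD('k) ^ m"
    by (simp add: card_cartesian_product card_lists_length)
  finally show ?thesis .
qed

lemma card_words_subset_le:
  fixes X Z :: "(nat \<Rightarrow> 'k::finite) set"
  assumes "Z \<subseteq> X" "\<W> \<subseteq> (\<Union>n. words Z n)"
  shows "card {W\<in>\<W>. length W = n} \<le> card (words X n)"
proof (rule card_mono)
  show "{W\<in>\<W>. length W = n} \<subseteq> words X n"
  proof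
    fix W assume W: "W \<in> {W\<in>\<W>. length W = n}"
    then have "cylinder W \<inter> Z \<noteq> {}"
      using assms(2) by (auto simp: mem_words_iff)
    then show "W \<in> words X n"
      using W assms(1) by (auto simp: mem_words_iff)
  qed
qed simp

context
  fixes X :: "(nat \<Rightarrow> 'k::finite) set"
  assumes X: "X \<noteq> {}"
begin

lemma card_words_ge_1: "real (card (words X n)) \<ge> 1"
  using card_words_pos[OF X, of n] by linarith

lemma growth_nonneg: "growth X \<ge> 0"
proof -
  have "0 \<le> liminf (\<lambda>n. ereal (ln (real (card (words X n))) / real n))"
    using card_words_ge_1 by (intro Liminf_bounded) (auto simp: ln_ge_zero)
  also have "\<dots> \<le> growth X"
    unfolding growth_def by (rule Liminf_le_Limsup) simp
  finally show ?thesis .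
qed

lemma eventually_card_words_le:
  assumes "growth X < ereal s"
  shows "eventually (\<lambda>n. real (card (words X n)) \<le> exp (s * real n)) sequentially"
  using Limsup_lessD[OF assms[unfolded growth_def]] eventually_gt_at_top[of 0]
proof eventually_elim
  case (elim n)
  then have "ln (real (card (words X n))) \<le> s * real n"
    by (simp add: divide_less_eq)
  then have "exp (ln (real (card (words X n)))) \<le> exp (s * real n)"
    by simp
  then show ?case
    using card_words_ge_1[of n] by simp
qed

lemma frequently_card_words_ge:
  assumes "ereal s < growth X"
  shows "frequently (\<lambda>n. exp (s * real n) \<le> real (card (words X n))) sequentially"
proof (rule ccontr)
  assume "\<not> ?thesis"
  then have "eventually (\<lambda>n. real (card (words X n)) < exp (s * real n)) sequentially"
    by (simp add: not_frequently not_le)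
  then have "eventually (\<lambda>n. ereal (ln (real (card (words X n))) / real n) \<le> ereal s) sequentially"
    using eventually_gt_at_top[of 0]
  proof eventually_elim
    case (elim n)
    then have "ln (real (card (words X n))) < ln (exp (s * real n))"
      using card_words_ge_1[of n] by (subst ln_less_cancel_iff) auto
    then show ?case
      using elim(2) by (simp add: divide_le_eq)
  qed
  then have "growth X \<le> ereal s"
    unfolding growth_def by (rule Limsup_bounded)
  with assms show False
    by simp
qed

text \<open>\<open>ln C / n\<close> tends to 0, so a constant factor does not show in the growth
  rate.\<close>

lemma growth_le:
  assumes "\<And>n. real (card (words X n)) \<le> C * exp (s * real n)"
  shows "growth X \<le> ereal s"
proof -
  have C: "C \<ge> 1"
    using assms[of 0] card_words_ge_1[of 0] by simp
  have "eventually (\<lambda>n. ereal (ln (real (card (words X n))) / real n) \<le> ereal (ln C / real n) + ereal s) sequentially"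
    using eventually_gt_at_top[of 0]
  proof eventually_elim
    case (elim n)
    have "ln (real (card (words X n))) \<le> ln (C * exp (s * real n))"
      using assms[of n] card_words_ge_1[of n] C by (subst ln_le_cancel_iff) auto
    also have "\<dots> = ln C + s * real n"
      using C by (subst ln_mult) auto
    finally show ?case
      using elim by (simp add: field_simps)
  qed
  then have "growth X \<le> limsup (\<lambda>n. ereal (ln C / real n) + ereal s)"
    unfolding growth_def by (rule Limsup_mono)
  also have "\<dots> = 0 + limsup (\<lambda>n. ereal s)"
  proof (rule ereal_limsup_lim_add)
    show "(\<lambda>n. ereal (ln C / real n)) \<longlonglongrightarrow> 0"
      unfolding zero_ereal_def by (intro tendsto_intros lim_const_over_n)
  qed simp
  finally show ?thesis
    by (simp add: Limsup_const)
qed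

text \<open>Words of a packing of \<open>Z\<close> belong to the language of \<open>X\<close>, and
  above its growth rate their total weight is a vanishing geometric tail. Thus \<open>Z\<close>
  itself, repeated as every \<open>Y i\<close>, is a cover by sets of content 0.\<close>

lemma packing_entropy_le_growth:
  assumes "Z \<subseteq> X"
  shows "packing_entropy Z \<le> growth X"
proof (rule ereal_le_if_all_real_above)
  fix s assume "growth X < ereal s"
  then obtain u where u: "growth X < ereal u" "ereal u < ereal s"
    using ereal_dense2 by blast
  obtain N where N: "\<And>n. n \<ge> N \<Longrightarrow> real (card (words X n)) \<le> exp (u * real n)"
    using eventually_card_words_le[OF u(1)] by (auto simp: eventually_sequentially)
  have le: "packing_premeasure s M Z \<le> ennreal (exp (u - s) ^ M / (1 - exp (u - s)))" if "M \<ge> N" for M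
    unfolding packing_premeasure_def
  proof (rule SUP_least, elim CollectE conjE)
    fix \<W> :: "'k list set"
    assume \<W>: "\<forall>W\<in>\<W>. cylinder W \<inter> Z \<noteq> {} \<and> M \<le> length W"
    show "(\<Sum>\<^sub>\<infinity>W\<in>\<W>. ennreal (exp (- s * real (length W)))) \<le> ennreal (exp (u - s) ^ M / (1 - exp (u - s)))"
    proof (rule infsum_words_le)
      fix n assume "n \<ge> M"
      have "card {W\<in>\<W>. length W = n} \<le> card (words X n)"
        using \<W> assms by (intro card_words_subset_le) (auto simp: mem_words_iff)
      then show "real (card {W\<in>\<W>. length W = n}) \<le> exp (u * real n)"
        using N[of n] that \<open>n \<ge> M\<close> by linarith
    qed (use \<W> u in auto)
  qed
  have "packing_content s Z = 0"
  proof (rule ennreal_eq_0_if_le_all)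
    fix e :: real assume "e > 0"
    have "eventually (\<lambda>M. exp (u - s) ^ M / (1 - exp (u - s)) < e \<and> M \<ge> N) sequentially"
      using u(2) \<open>e > 0\<close> by (intro eventually_conj order_tendstoD[OF geometric_tail_tendsto] eventually_ge_at_top) auto
    then obtain M where M: "exp (u - s) ^ M / (1 - exp (u - s)) < e" "M \<ge> N"
      by (auto simp: eventually_sequentially)
    have "packing_content s Z \<le> packing_premeasure s M Z"
      unfolding packing_content_eq_INF by (rule INF_lower) simp
    also have "\<dots> \<le> ennreal e"
      using le[OF M(2)] M(1) by (meson ennreal_leI less_imp_le order_trans)
    finally show "packing_content s Z \<le> ennreal e" .
  qed
  then have "packing_measure s Z \<le> (\<Sum>i::nat. 0)"
    unfolding packing_measure_def by (intro INF_lower2[of "\<lambda>_. Z"]) auto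
  moreover have "s \<ge> 0"
    using \<open>growth X < ereal s\<close> growth_nonneg by (metis ereal_less_eq(5) less_imp_le order_trans)
  ultimately show "packing_entropy Z \<le> ereal s"
    unfolding packing_entropy_def by (intro INF_lower) simp
qed

text \<open>The words of one large length \<open>M\<close> form a cover whose weight is bounded by a
  geometric tail.\<close>

lemma bowen_entropy_le_growth: "bowen_entropy X \<le> growth X"
proof (rule ereal_le_if_all_real_above)
  fix s assume "growth X < ereal s"
  then obtain u where u: "growth X < ereal u" "ereal u < ereal s"
    using ereal_dense2 by blast
  obtain N where N: "\<And>n. n \<ge> N \<Longrightarrow> real (card (words X n)) \<le> exp (u * real n)"
    using eventually_card_words_le[OF u(1)] by (auto simp: eventually_sequentially)
  have "s > 0"
    using \<open>growth X < ereal s\<close> growth_nonneg by (metis ereal_less(2) order_le_less_trans)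
  moreover have "cylinder_null s X"
    unfolding cylinder_null_def
  proof (intro allI impI)
    fix e :: real assume "e > 0"
    have "eventually (\<lambda>M. exp (u - s) ^ M / (1 - exp (u - s)) < e \<and> M \<ge> N) sequentially"
      using u(2) \<open>e > 0\<close> by (intro eventually_conj order_tendstoD[OF geometric_tail_tendsto] eventually_ge_at_top) auto
    then obtain M where M: "exp (u - s) ^ M / (1 - exp (u - s)) < e" "M \<ge> N"
      by (auto simp: eventually_sequentially)
    have "(\<Sum>\<^sub>\<infinity>W\<in>words X M. ennreal (exp (- s * real (length W)))) \<le> ennreal (exp (u - s) ^ M / (1 - exp (u - s)))"
    proof (rule infsum_words_le)
      fix n assume "n \<ge> M"
      have "card {W\<in>words X M. length W = n} \<le> card (words X n)"
        by (rule card_words_subset_le) auto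
      then show "real (card {W\<in>words X M. length W = n}) \<le> exp (u * real n)"
        using N[of n] \<open>n \<ge> M\<close> M(2) by linarith
    qed (use u length_words in auto)
    also have "\<dots> \<le> ennreal e"
      using M(1) by (intro ennreal_leI) simp
    finally have "(\<Sum>\<^sub>\<infinity>W\<in>words X M. ennreal (exp (- s * real (length W)))) \<le> ennreal e" .
    moreover have "X \<subseteq> (\<Union>W\<in>words X M. cylinder W)"
      by (auto simp: words_def mem_cylinder_pre_iff)
    ultimately show "\<exists>\<W>. X \<subseteq> (\<Union>W\<in>\<W>. cylinder W) \<and>
        (\<Sum>\<^sub>\<infinity>W\<in>\<W>. ennreal (exp (- s * real (length W)))) \<le> ennreal e"
      by blast
  qed
  ultimately show "bowen_entropy X \<le> ereal s"
    unfolding bowen_entropy_def by (intro INF_lower) (simp add: bowen_measure_eq_0_iff)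
qed

end


section \<open>Bowen entropy of a subshift\<close>

text \<open>Compactness in the form of Konig's lemma. A word without a finite subcover has a
  one-letter extension without one; following such extensions from the empty word leads, by
  \<open>closed\<close>, to a point of \<open>X\<close>, but some prefix of that point is itself a
  word of the cover.\<close>

lemma finite_cylinder_subcover:
  fixes X :: "(nat \<Rightarrow> 'k::finite) set"
  assumes closed: "\<And>x. (\<And>n. pre x n \<in> words X n) \<Longrightarrow> x \<in> X"
    and cover: "X \<subseteq> (\<Union>W\<in>\<W>. cylinder W)"
  obtains F where "finite F" "F \<subseteq> \<W>" "X \<subseteq> (\<Union>W\<in>F. cylinder W)"
proof -
  define good where "good V \<longleftrightarrow> (\<exists>F. finite F \<and> F \<subseteq> \<W> \<and> X \<inter> cylinder V \<subseteq> (\<Union>W\<in>F. cylinder W))" for V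
  have good_step: "good V" if "\<And>a. good (V @ [a])" for V
  proof -
    have "\<forall>a. \<exists>F. finite F \<and> F \<subseteq> \<W> \<and> X \<inter> cylinder (V @ [a]) \<subseteq> (\<Union>W\<in>F. cylinder W)"
      using that unfolding good_def by blast
    from choice[OF this] obtain F where F: "\<And>a. finite (F a)" "\<And>a. F a \<subseteq> \<W>"
      "\<And>a. X \<inter> cylinder (V @ [a]) \<subseteq> (\<Union>W\<in>F a. cylinder W)"
      by blast
    have "x \<in> (\<Union>W\<in>(\<Union>a. F a). cylinder W)" if x: "x \<in> X" "x \<in> cylinder V" for x
    proof -
      have "x \<in> cylinder (V @ [x (length V)])"
        using x(2) by (auto simp: cylinder_def nth_append less_Suc_eq)
      with F(3) x(1) show ?thesis
        by blast
    qed
    then show ?thesis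
      unfolding good_def using F(1,2) by (intro exI[of _ "\<Union>a. F a"]) auto
  qed
  have "good []"
  proof (rule ccontr)
    assume "\<not> good []"
    then have "\<exists>f. \<forall>n. (length (f n) = n \<and> \<not> good (f n)) \<and> (\<exists>a. f (Suc n) = f n @ [a])"
    proof (intro dependent_nat_choice)
      show "\<exists>W. (length W = Suc n \<and> \<not> good W) \<and> (\<exists>a. W = V @ [a])"
        if "length V = n \<and> \<not> good V" for V n
        using good_step[of V] that by (metis length_append_singleton)
    qed auto
    then obtain f where f: "\<And>n. length (f n) = n" "\<And>n. \<not> good (f n)" "\<And>n. \<exists>a. f (Suc n) = f n @ [a]"
      by blast
    define x where "x n = f (Suc n) ! n" for n
    have pre_x: "pre x n = f n" for n
    proof (induction n)
      case 0
      then show ?case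
        using f(1)[of 0] by (simp add: pre_def)
    next
      case (Suc n)
      obtain a where a: "f (Suc n) = f n @ [a]"
        using f(3) by blast
      have "pre x (Suc n) = pre x n @ [x n]"
        by (simp add: pre_def)
      moreover have "x n = a"
        using a f(1)[of n] by (simp add: x_def nth_append)
      ultimately show ?case
        using Suc a by simp
    qed
    have "pre x n \<in> words X n" for n
    proof -
      have "X \<inter> cylinder (pre x n) \<noteq> {}"
        using f(2)[of n] unfolding pre_x good_def by blast
      then show ?thesis
        by (auto simp: mem_words_iff)
    qed
    then have "x \<in> X"
      by (rule closed)
    then obtain W where W: "W \<in> \<W>" "x \<in> cylinder W"
      using cover by blast
    then have "f (length W) = W"
      using pre_x[of "length W"] by (simp add: mem_cylinder_iff)
    then have "good (f (length W))"
      unfolding good_def using W(1) by (intro exI[of _ "{W}"]) auto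
    with f(2) show False
      by blast
  qed
  then show ?thesis
    using that by (auto simp: good_def cylinder_def)
qed

text \<open>
  A finite cover by cylinders cuts every point of the subshift into words of the cover, so the
  number of words of length \<open>n\<close> satisfies the recursive inequality that is solved here by induction.
\<close>

lemma growth_le_bowen_entropy:
  fixes X :: "(nat \<Rightarrow> 'k::finite) set"
  assumes X: "X \<noteq> {}" and closed: "\<And>x. (\<And>n. pre x n \<in> words X n) \<Longrightarrow> x \<in> X"
    and inv: "\<And>x n. x \<in> X \<Longrightarrow> (\<lambda>i. x (n + i)) \<in> X"
  shows "growth X \<le> bowen_entropy X"
  unfolding bowen_entropy_def
proof (rule INF_greatest, elim CollectE conjE)
  fix s :: real assume s: "s \<ge> 0" "bowen_measure s X = 0"
  have "s \<noteq> 0"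
    using bowen_measure_0_imp_empty[of X] s(2) X by auto
  then have "s > 0"
    using s(1) by simp
  then have "cylinder_null s X"
    using s(2) by (simp add: bowen_measure_eq_0_iff)
  \<comment> \<open>The total weight only has to stay below 1: this keeps the empty word, of weight
    1, out of the cover and lets the induction on \<open>n\<close> close.\<close>
  then obtain \<W> where \<W>: "X \<subseteq> (\<Union>W\<in>\<W>. cylinder W)"
    "(\<Sum>\<^sub>\<infinity>W\<in>\<W>. ennreal (exp (- s * real (length W)))) \<le> ennreal (1 / 2)"
    unfolding cylinder_null_def by (meson half_gt_zero zero_less_one)
  obtain F where F: "finite F" "F \<subseteq> \<W>" "X \<subseteq> (\<Union>W\<in>F. cylinder W)"
    using finite_cylinder_subcover[OF closed \<W>(1)] by blast
  have "ennreal (\<Sum>W\<in>F. exp (- s * real (length W))) \<le> ennreal (1 / 2)"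
    using order_trans[OF sum_le_infsum_ennreal[OF F(1,2)] \<W>(2)] by (subst sum_ennreal[symmetric]) simp_all
  then have sumF: "(\<Sum>W\<in>F. exp (- s * real (length W))) \<le> 1 / 2"
    by (subst (asm) ennreal_le_iff) simp_all
  have len_pos: "length W > 0" if "W \<in> F" for W
  proof (rule ccontr)
    assume "\<not> length W > 0"
    then have "1 \<le> (\<Sum>W\<in>F. exp (- s * real (length W)))"
      using member_le_sum[of W F "\<lambda>W. exp (- s * real (length W))"] F(1) that by simp
    with sumF show False
      by simp
  qed
  obtain m where m: "\<And>W. W \<in> F \<Longrightarrow> length W < m"
    by (metis F(1) finite_nat_set_iff_bounded finite_imageI image_eqI)
  \<comment> \<open>\<open>C\<close> bounds the number of words of each length below
    \<open>m\<close>, which are the base cases of the induction.\<close>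
  define C where "C = real (CARD('k) ^ m)"
  have "real (card (words X n)) \<le> C * exp (s * real n)" for n
  proof (induction n rule: less_induct)
    case (less n)
    show ?case
    proof (cases "n < m")
      case True
      have "card (words X n) \<le> card {W :: 'k list. length W = n}"
        by (intro card_mono finite_lists_length) (auto simp: length_words)
      also have "\<dots> \<le> CARD('k) ^ m"
        unfolding card_lists_length using True by (intro power_increasing) (auto simp: Suc_leI)
      finally have "real (card (words X n)) \<le> C"
        unfolding C_def by (rule of_nat_mono)
      also have "\<dots> \<le> C * exp (s * real n)"
        using \<open>s > 0\<close> by (simp add: C_def)
      finally show ?thesis .
    next
      case False
      \<comment> \<open>The covering word at the start of \<open>x\<close> is cut off; by
        \<open>inv\<close> the remainder is again the prefix of a point of \<open>X\<close>.\<close>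
      have "words X n \<subseteq> (\<Union>W\<in>F. (@) W ` words X (n - length W))"
      proof
        fix V assume "V \<in> words X n"
        then obtain x where x: "x \<in> X" "V = pre x n"
          by (auto simp: words_def)
        then obtain W where W: "W \<in> F" "x \<in> cylinder W"
          using F(3) by blast
        define l where "l = length W"
        have "l + (n - l) = n"
          using m[OF W(1)] False by (simp add: l_def)
        then have "V = pre x l @ pre (\<lambda>i. x (l + i)) (n - l)"
          using pre_add[of x l "n - l"] x(2) by simp
        moreover have "pre x l = W"
          using W(2) by (simp add: l_def mem_cylinder_iff)
        ultimately show "V \<in> (\<Union>W\<in>F. (@) W ` words X (n - length W))"
          using W(1) inv[OF x(1), of l] by (auto simp: words_def l_def)
      qed
      then have "card (words X n) \<le> card (\<Union>W\<in>F. (@) W ` words X (n - length W))"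
        using F(1) by (intro card_mono) auto
      also have "\<dots> \<le> (\<Sum>W\<in>F. card ((@) W ` words X (n - length W)))"
        by (rule card_UN_le[OF F(1)])
      also have "\<dots> \<le> (\<Sum>W\<in>F. card (words X (n - length W)))"
        by (intro sum_mono card_image_le) simp
      finally have "real (card (words X n)) \<le> (\<Sum>W\<in>F. real (card (words X (n - length W))))"
        by (simp flip: of_nat_sum)
      also have "\<dots> \<le> (\<Sum>W\<in>F. C * exp (s * real n) * exp (- s * real (length W)))"
      proof (rule sum_mono)
        fix W assume W: "W \<in> F"
        have "real (card (words X (n - length W))) \<le> C * exp (s * real (n - length W))"
          using len_pos[OF W] m[OF W] False by (intro less) simp
        also have "s * real (n - length W) = s * real n + - s * real (length W)"
          using m[OF W] False by (simp add: algebra_simps of_nat_diff)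
        finally show "real (card (words X (n - length W))) \<le> C * exp (s * real n) * exp (- s * real (length W))"
          by (simp only: exp_add mult.assoc)
      qed
      also have "\<dots> = C * exp (s * real n) * (\<Sum>W\<in>F. exp (- s * real (length W)))"
        by (rule sum_distrib_left[symmetric])
      also have "\<dots> \<le> C * exp (s * real n) * 1"
        using sumF by (intro mult_left_mono) (auto simp: C_def)
      finally show ?thesis
        by simp
    qed
  qed
  then show "growth X \<le> ereal s"
    by (rule growth_le[OF X])
qed


section \<open>Topological entropy of a subshift\<close>

lemma shift_funpow: "(shift ^^ i) x = (\<lambda>j. x (i + j))"
  by (induction i) (auto simp: shift_def)

lemma rho_eq_1: "x 0 \<noteq> y 0 \<Longrightarrow> rho x y = 1"
  by (auto simp: rho_def)

lemma rho_eq_0_if_CARD_less_2: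
  fixes x y :: "nat \<Rightarrow> 'k::finite"
  assumes "CARD('k) < 2"
  shows "rho x y = 0"
proof -
  have "CARD('k) = 1"
    using assms zero_less_card_finite[where 'a = 'k] by linarith
  then have "a = b" for a b :: 'k
    by (metis UNIV_I card_1_singletonE singletonD)
  then have "x = y"
    by blast
  then show ?thesis
    by (simp add: rho_def)
qed

text \<open>Points that agree on \<open>n + m\<close> letters stay within \<open>\<epsilon>\<close>
  for \<open>n\<close> steps, so a separated set exceeds the word count by at most the factor
  \<open>K ^ m\<close>. Conversely, one point for each word of length \<open>n\<close> gives a set
  separated at scale 1/2, since points with different first letters have distance 1.\<close>

lemma topological_entropy_eq_growth:
  fixes X :: "(nat \<Rightarrow> 'k::finite) set"
  assumes X: "X \<noteq> {}"
  shows "Metric_space.topological_entropy X rho shift = growth X"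
proof (rule antisym)
  let ?sep = "\<lambda>n \<epsilon>. {E. finite E \<and> Metric_space.separated_set X rho shift n \<epsilon> E}"
  show "Metric_space.topological_entropy X rho shift \<le> growth X"
    unfolding Metric_space.topological_entropy_def[OF Metric_space_rho]
  proof (rule SUP_least)
    fix \<epsilon> :: real assume "\<epsilon> \<in> {0<..}"
    then have "\<epsilon> > 0"
      by simp
    have "\<exists>m. \<forall>x y :: nat \<Rightarrow> 'k. (\<forall>i<m. x i = y i) \<longrightarrow> rho x y \<le> \<epsilon>"
    proof (cases "CARD('k) \<ge> 2")
      case True
      obtain m where "inverse (real CARD('k) ^ m) \<le> min \<epsilon> 1"
        using mcball_eq_cylinder[OF True, of "min \<epsilon> 1"] \<open>\<epsilon> > 0\<close>
        by (metis min.cobounded2 min_less_iff_conj zero_less_one)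
      then have "rho x y \<le> \<epsilon>" if "\<forall>i<m. x i = y i" for x y :: "nat \<Rightarrow> 'k"
        using rho_le_iff[OF True, of x y m] that by simp
      then show ?thesis
        by blast
    next
      case False
      then have "rho x y \<le> \<epsilon>" for x y :: "nat \<Rightarrow> 'k"
        using rho_eq_0_if_CARD_less_2[of x y] \<open>\<epsilon> > 0\<close> by (simp add: not_le)
      then show ?thesis
        by blast
    qed
    then obtain m where m: "\<And>x y :: nat \<Rightarrow> 'k. (\<forall>i<m. x i = y i) \<Longrightarrow> rho x y \<le> \<epsilon>"
      by blast
    have card: "card E \<le> card (words X n) * CARD('k) ^ m" if "E \<in> ?sep n \<epsilon>" for E n
    proof -
      have E: "E \<subseteq> X" "\<And>x y. x \<in> E \<Longrightarrow> y \<in> E \<Longrightarrow> x \<noteq> y \<Longrightarrow> \<exists>i<n. rho ((shift ^^ i) x) ((shift ^^ i) y) > \<epsilon>"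
        using that by (auto simp: Metric_space.separated_set_def[OF Metric_space_rho])
      have "inj_on (\<lambda>x. pre x (n + m)) E"
      proof (rule inj_onI, rule ccontr)
        fix x y assume xy: "x \<in> E" "y \<in> E" "pre x (n + m) = pre y (n + m)" "x \<noteq> y"
        then obtain i where i: "i < n" "rho ((shift ^^ i) x) ((shift ^^ i) y) > \<epsilon>"
          using E(2) by blast
        have "rho ((shift ^^ i) x) ((shift ^^ i) y) \<le> \<epsilon>"
          using xy(3) i(1) by (intro m) (auto simp: pre_eq_iff shift_funpow)
        with i(2) show False
          by simp
      qed
      then have "card E \<le> card (words X (n + m))"
        using E(1) by (intro card_inj_on_le[of "\<lambda>x. pre x (n + m)"] finite_words) (auto simp: words_def)
      also have "\<dots> \<le> card (words X n) * CARD('k) ^ m"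
        by (rule card_words_add_le)
      finally show ?thesis .
    qed
    have "limsup (\<lambda>n. SUP E\<in>?sep n \<epsilon>. ereal (ln (real (card E)) / real n))
        \<le> limsup (\<lambda>n. ereal (ln (real CARD('k) ^ m) / real n) + ereal (ln (real (card (words X n))) / real n))"
    proof (rule Limsup_mono, rule always_eventually, rule allI, rule SUP_least)
      fix n E assume E: "E \<in> ?sep n \<epsilon>"
      have pos: "real (card (words X n)) \<ge> 1"
        by (rule card_words_ge_1[OF X])
      have K: "real CARD('k) ^ m \<ge> 1"
        by (rule one_le_power) (simp add: Suc_leI)
      have "ln (real (card E)) \<le> ln (real CARD('k) ^ m) + ln (real (card (words X n)))"
      proof (cases "card E = 0")
        case True
        then show ?thesis
          using pos K by (simp add: ln_ge_zero)
      next
        case False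
        have "real (card E) \<le> real (card (words X n) * CARD('k) ^ m)"
          using card[OF E] by (rule of_nat_mono)
        then have "ln (real (card E)) \<le> ln (real CARD('k) ^ m * real (card (words X n)))"
          using False pos K by (subst ln_le_cancel_iff) (auto simp: mult.commute)
        also have "\<dots> = ln (real CARD('k) ^ m) + ln (real (card (words X n)))"
          using pos K by (subst ln_mult) auto
        finally show ?thesis .
      qed
      then have "ln (real (card E)) / real n
          \<le> (ln (real CARD('k) ^ m) + ln (real (card (words X n)))) / real n"
        by (rule divide_right_mono) simp
      then show "ereal (ln (real (card E)) / real n)
          \<le> ereal (ln (real CARD('k) ^ m) / real n) + ereal (ln (real (card (words X n))) / real n)"
        by (simp add: add_divide_distrib)
    qed
    also have "\<dots> = 0 + growth X"
      unfolding growth_def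
    proof (rule ereal_limsup_lim_add)
      show "(\<lambda>n. ereal (ln (real CARD('k) ^ m) / real n)) \<longlonglongrightarrow> 0"
        unfolding zero_ereal_def by (intro tendsto_intros lim_const_over_n)
    qed simp
    finally show "limsup (\<lambda>n. SUP E\<in>?sep n \<epsilon>. ereal (ln (real (card E)) / real n)) \<le> growth X"
      by simp
  qed
  have sep: "\<exists>E\<in>?sep n (1/2). card E = card (words X n)" for n
  proof -
    define g where "g W = (SOME x. x \<in> X \<and> pre x n = W)" for W
    have g: "g W \<in> X \<and> pre (g W) n = W" if "W \<in> words X n" for W
    proof -
      have "\<exists>x. x \<in> X \<and> pre x n = W"
        using that by (auto simp: words_def)
      then show ?thesis
        unfolding g_def by (rule someI_ex)
    qed
    have inj: "inj_on g (words X n)"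
      by (rule inj_on_inverseI[of _ "\<lambda>x. pre x n"]) (simp add: g)
    have "Metric_space.separated_set X rho shift n (1/2) (g ` words X n)"
      unfolding Metric_space.separated_set_def[OF Metric_space_rho]
    proof (intro conjI ballI impI)
      fix x y assume "x \<in> g ` words X n" "y \<in> g ` words X n" "x \<noteq> y"
      then have "pre x n \<noteq> pre y n"
        using g by auto
      then obtain i where "i < n" "x i \<noteq> y i"
        by (auto simp: pre_eq_iff)
      then show "\<exists>i<n. rho ((shift ^^ i) x) ((shift ^^ i) y) > 1/2"
        by (intro exI[of _ i]) (simp add: shift_funpow rho_eq_1)
    qed (use g in auto)
    with inj show ?thesis
      by (intro bexI[of _ "g ` words X n"]) (auto simp: card_image)
  qed
  have "growth X \<le> limsup (\<lambda>n. SUP E\<in>?sep n (1/2). ereal (ln (real (card E)) / real n))"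
    unfolding growth_def
  proof (rule Limsup_mono, rule always_eventually, rule allI)
    fix n
    obtain E where "E \<in> ?sep n (1/2)" "card E = card (words X n)"
      using sep by blast
    then show "ereal (ln (real (card (words X n))) / real n) \<le> (SUP E\<in>?sep n (1/2). ereal (ln (real (card E)) / real n))"
      by (intro SUP_upper2[of E]) auto
  qed
  also have "\<dots> \<le> Metric_space.topological_entropy X rho shift"
    unfolding Metric_space.topological_entropy_def[OF Metric_space_rho] by (rule SUP_upper) simp
  finally show "growth X \<le> Metric_space.topological_entropy X rho shift" .
qed


section \<open>Mean Li--Yorke pairs\<close>

definition orbit_avg :: "(nat \<Rightarrow> 'k::finite) \<Rightarrow> (nat \<Rightarrow> 'k) \<Rightarrow> nat \<Rightarrow> real" where
  "orbit_avg x y n = (\<Sum>i<n. rho ((shift ^^ i) x) ((shift ^^ i) y)) / real n"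

lemma orbit_avg_nonneg: "orbit_avg x y n \<ge> 0"
  by (simp add: orbit_avg_def sum_nonneg rho_nonneg)

text \<open>The averages are nonnegative, so a liminf equal to 0 means falling below every positive
  threshold infinitely often. Later arguments can then work with single times
  \<open>n\<close>.\<close>

lemma mean_li_yorke_set_iff:
  "y \<in> Metric_space.mean_li_yorke_set X rho shift x \<longleftrightarrow> y \<in> X \<and>
    (\<forall>\<delta>>0. frequently (\<lambda>n. orbit_avg x y n < \<delta>) sequentially) \<and>
    (\<exists>\<delta>>0. frequently (\<lambda>n. orbit_avg x y n \<ge> \<delta>) sequentially)"
proof -
  let ?a = "\<lambda>n. ereal (orbit_avg x y n)"
  have "0 \<le> liminf ?a"
    by (rule Liminf_bounded) (simp add: orbit_avg_nonneg)
  then have "liminf ?a = 0 \<longleftrightarrow> \<not> 0 < liminf ?a"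
    by auto
  also have "0 < liminf ?a \<longleftrightarrow> (\<exists>\<delta>>0. eventually (\<lambda>n. \<delta> \<le> orbit_avg x y n) sequentially)"
  proof
    assume "0 < liminf ?a"
    then obtain \<delta> where \<delta>: "0 < ereal \<delta>" "ereal \<delta> < liminf ?a"
      using ereal_dense2 by blast
    have "eventually (\<lambda>n. \<delta> \<le> orbit_avg x y n) sequentially"
      using less_LiminfD[OF \<delta>(2)] by eventually_elim simp
    with \<delta>(1) show "\<exists>\<delta>>0. eventually (\<lambda>n. \<delta> \<le> orbit_avg x y n) sequentially"
      by auto
  next
    assume "\<exists>\<delta>>0. eventually (\<lambda>n. \<delta> \<le> orbit_avg x y n) sequentially"
    then obtain \<delta> where \<delta>: "\<delta> > 0" "eventually (\<lambda>n. \<delta> \<le> orbit_avg x y n) sequentially"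
      by blast
    then have "ereal \<delta> \<le> liminf ?a"
      by (intro Liminf_bounded) simp
    moreover have "0 < ereal \<delta>"
      using \<delta>(1) by simp
    ultimately show "0 < liminf ?a"
      by (rule less_le_trans[rotated])
  qed
  finally have inf: "liminf ?a = 0 \<longleftrightarrow> (\<forall>\<delta>>0. frequently (\<lambda>n. orbit_avg x y n < \<delta>) sequentially)"
    by (simp add: frequently_def not_less) (meson not_le)
  have sup: "limsup ?a > 0 \<longleftrightarrow> (\<exists>\<delta>>0. frequently (\<lambda>n. orbit_avg x y n \<ge> \<delta>) sequentially)"
  proof
    assume "limsup ?a > 0"
    then obtain \<delta> where \<delta>: "0 < ereal \<delta>" "ereal \<delta> < limsup ?a"
      using ereal_dense2 by blast
    have "frequently (\<lambda>n. orbit_avg x y n \<ge> \<delta>) sequentially"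
    proof (rule ccontr)
      assume "\<not> frequently (\<lambda>n. orbit_avg x y n \<ge> \<delta>) sequentially"
      then have "limsup ?a \<le> ereal \<delta>"
        by (intro Limsup_bounded) (auto simp: frequently_def not_le elim: eventually_mono)
      with \<delta>(2) show False
        by simp
    qed
    with \<delta>(1) show "\<exists>\<delta>>0. frequently (\<lambda>n. orbit_avg x y n \<ge> \<delta>) sequentially"
      by auto
  next
    assume "\<exists>\<delta>>0. frequently (\<lambda>n. orbit_avg x y n \<ge> \<delta>) sequentially"
    then obtain \<delta> where \<delta>: "\<delta> > 0" "frequently (\<lambda>n. orbit_avg x y n \<ge> \<delta>) sequentially"
      by blast
    have "ereal \<delta> \<le> limsup ?a"
    proof (rule ccontr)
      assume "\<not> ereal \<delta> \<le> limsup ?a"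
      then have "eventually (\<lambda>n. ?a n < ereal \<delta>) sequentially"
        by (intro Limsup_lessD) simp
      with \<delta>(2) show False
        by (simp add: frequently_def not_le)
    qed
    moreover have "0 < ereal \<delta>"
      using \<delta>(1) by simp
    ultimately show "limsup ?a > 0"
      by (rule less_le_trans[rotated])
  qed
  show ?thesis
    using inf sup
    by (simp add: Metric_space.mean_li_yorke_set_def[OF Metric_space_rho]
        Metric_space.mean_li_yorke_pair_def[OF Metric_space_rho] orbit_avg_def)
qed

text \<open>A disagreement at position \<open>i\<close> puts the \<open>i\<close>-th shifts at
  distance 1. This is how averages of distances turn into Hamming distances of words.\<close>

lemma card_diff_le_orbit_avg:
  "real (card {i. i < n \<and> x i \<noteq> y i}) \<le> orbit_avg x y n * real n"
proof -
  have "real (card {i. i < n \<and> x i \<noteq> y i}) = (\<Sum>i<n. if x i \<noteq> y i then 1 else 0)"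
    by (simp add: sum.If_cases lessThan_def Collect_conj_eq Int_commute)
  also have "\<dots> \<le> (\<Sum>i<n. rho ((shift ^^ i) x) ((shift ^^ i) y))"
    by (intro sum_mono) (auto simp: shift_funpow rho_eq_1 rho_nonneg)
  also have "\<dots> = orbit_avg x y n * real n"
    by (simp add: orbit_avg_def)
  finally show ?thesis .
qed


section \<open>Bowen entropy of sets of points close to a given point\<close>

text \<open>
  Weighting a word by \<open>r\<close> to the power of its Hamming distance from \<open>\<omega>\<close> gives total weight
  \<open>(1 + (K - 1) r) ^ n\<close>; for small \<open>r\<close> this bounds the number of words at small distance.
\<close>

lemma sum_hamming_weights_le:
  fixes \<omega> :: "nat \<Rightarrow> 'k::finite" and r :: real
  assumes "r \<ge> 0"
  shows "(\<Sum>W | length W = n. r ^ card {i. i < n \<and> W ! i \<noteq> \<omega> i}) \<le> (1 + real CARD('k) * r) ^ n"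
proof (induction n)
  case 0
  then show ?case
    by simp
next
  case (Suc n)
  define f where "f = (\<lambda>(V, a). V @ [a :: 'k])"
  have inj: "inj_on f ({V. length V = n} \<times> UNIV)"
    by (auto simp: inj_on_def f_def)
  have img: "{W. length W = Suc n} = f ` ({V. length V = n} \<times> UNIV)"
  proof (intro equalityI subsetI)
    fix W :: "'k list" assume "W \<in> {W. length W = Suc n}"
    then show "W \<in> f ` ({V. length V = n} \<times> UNIV)"
      by (intro image_eqI[of _ _ "(butlast W, last W)"])
        (auto simp: f_def intro: append_butlast_last_id[symmetric])
  qed (auto simp: f_def)
  have card: "card {i. i < Suc n \<and> (V @ [a]) ! i \<noteq> \<omega> i} =
      card {i. i < n \<and> V ! i \<noteq> \<omega> i} + (if a = \<omega> n then 0 else 1)" if "length V = n" for V a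
  proof -
    have "{i. i < Suc n \<and> (V @ [a]) ! i \<noteq> \<omega> i} = {i. i < n \<and> V ! i \<noteq> \<omega> i} \<union> (if a = \<omega> n then {} else {n})"
      using that by (auto simp: nth_append less_Suc_eq)
    then show ?thesis
      by (auto simp: card_insert_if)
  qed
  have "(\<Sum>W | length W = Suc n. r ^ card {i. i < Suc n \<and> W ! i \<noteq> \<omega> i}) =
      (\<Sum>(V, a)\<in>{V. length V = n} \<times> UNIV. r ^ card {i. i < n \<and> V ! i \<noteq> \<omega> i} * (if a = \<omega> n then 1 else r))"
    unfolding img sum.reindex[OF inj]
  proof (rule sum.cong[OF refl])
    fix p :: "'k list \<times> 'k" assume "p \<in> {V. length V = n} \<times> UNIV"
    then show "((\<lambda>W. r ^ card {i. i < Suc n \<and> W ! i \<noteq> \<omega> i}) \<circ> f) p =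
        (case p of (V, a) \<Rightarrow> r ^ card {i. i < n \<and> V ! i \<noteq> \<omega> i} * (if a = \<omega> n then 1 else r))"
      using card[of "fst p" "snd p"] by (cases p) (simp add: f_def power_add)
  qed
  also have "\<dots> = (\<Sum>V | length V = n. r ^ card {i. i < n \<and> V ! i \<noteq> \<omega> i}) * (\<Sum>a\<in>UNIV. if a = \<omega> n then 1 else r)"
    by (simp add: sum_product sum.cartesian_product)
  also have "\<dots> \<le> (1 + real CARD('k) * r) ^ n * (1 + real CARD('k) * r)"
  proof (rule mult_mono[OF Suc])
    \<comment> \<open>Charging \<open>r\<close> for the letter \<open>\<omega> n\<close> as well
      gives \<open>K * r\<close> in place of \<open>(K - 1) * r\<close>.\<close>
    have "(\<Sum>a\<in>UNIV. if a = \<omega> n then 1 else r) \<le> (\<Sum>a\<in>UNIV. (if a = \<omega> n then 1 else 0) + r)"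
      using assms by (intro sum_mono) auto
    also have "\<dots> = 1 + real CARD('k) * r"
      by (simp add: sum.distrib)
    finally show "(\<Sum>a\<in>UNIV. if a = \<omega> n then 1 else r) \<le> 1 + real CARD('k) * r" .
  qed (use assms in \<open>auto intro!: sum_nonneg\<close>)
  finally show ?case
    by (simp add: mult.commute)
qed

text \<open>An exponential Markov bound: with weight \<open>exp (- b)\<close> to the Hamming
  distance, each word of the ball weighs at least \<open>exp (- (s / 2) * n)\<close>, while all
  words together weigh at most \<open>exp (s / 2 * n)\<close>. The radius \<open>\<delta>\<close> is
  the same for all \<open>n\<close>.\<close>

lemma exists_hamming_ball_card_le:
  fixes \<omega> :: "nat \<Rightarrow> 'k::finite"
  assumes "s > 0"
  obtains \<delta> where "\<delta> > 0"
    "\<And>n. real (card {W :: 'k list. length W = n \<and> real (card {i. i < n \<and> W ! i \<noteq> \<omega> i}) \<le> \<delta> * real n}) \<le> exp (s * real n)"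
proof -
  define K where "K = real CARD('k)"
  have "K > 0"
    by (simp add: K_def)
  \<comment> \<open>\<open>b\<close> is chosen for \<open>K * exp (- b) \<le> s / 2\<close>, with
    the maximum keeping it positive; \<open>\<delta>\<close> then solves
    \<open>b * \<delta> = s / 2\<close>.\<close>
  define b where "b = max 1 (- ln (s / (2 * K)))"
  define \<delta> where "\<delta> = s / (2 * b)"
  have b: "b \<ge> 1"
    by (simp add: b_def)
  have "exp (- b) \<le> exp (ln (s / (2 * K)))"
    by (simp add: b_def)
  then have Kb: "K * exp (- b) \<le> s / 2"
    using \<open>s > 0\<close> \<open>K > 0\<close> by (simp add: field_simps)
  have "real (card {W :: 'k list. length W = n \<and> real (card {i. i < n \<and> W ! i \<noteq> \<omega> i}) \<le> \<delta> * real n}) \<le> exp (s * real n)"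
    (is "real (card ?B) \<le> _") for n
  proof -
    have "real (card ?B) * exp (- (s / 2) * real n) = (\<Sum>W\<in>?B. exp (- (s / 2) * real n))"
      by simp
    also have "\<dots> \<le> (\<Sum>W\<in>?B. exp (- b) ^ card {i. i < n \<and> W ! i \<noteq> \<omega> i})"
    proof (rule sum_mono)
      fix W assume "W \<in> ?B"
      then have "b * real (card {i. i < n \<and> W ! i \<noteq> \<omega> i}) \<le> b * (\<delta> * real n)"
        using b by (intro mult_left_mono) auto
      also have "\<dots> = s / 2 * real n"
        using b by (simp add: \<delta>_def)
      finally have "exp (- (s / 2) * real n) \<le> exp (real (card {i. i < n \<and> W ! i \<noteq> \<omega> i}) * - b)"
        by (simp add: mult.commute)
      then show "exp (- (s / 2) * real n) \<le> exp (- b) ^ card {i. i < n \<and> W ! i \<noteq> \<omega> i}"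
        by (simp only: exp_of_nat_mult)
    qed
    also have "\<dots> \<le> (\<Sum>W | length W = n. exp (- b) ^ card {i. i < n \<and> W ! i \<noteq> \<omega> i})"
      by (intro sum_mono2 finite_lists_length) auto
    also have "\<dots> \<le> (1 + K * exp (- b)) ^ n"
      unfolding K_def by (rule sum_hamming_weights_le) simp
    also have "\<dots> \<le> exp (K * exp (- b)) ^ n"
      using \<open>K > 0\<close> by (intro power_mono exp_ge_add_one_self) (auto intro: add_nonneg_nonneg)
    also have "\<dots> \<le> exp (s / 2) ^ n"
      using Kb by (intro power_mono) auto
    also have "\<dots> = exp (s / 2 * real n)"
      by (simp add: mult.commute flip: exp_of_nat_mult)
    finally have "real (card ?B) * exp (- (s / 2) * real n) * exp (s / 2 * real n) \<le> exp (s / 2 * real n) * exp (s / 2 * real n)"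
      by (rule mult_right_mono) simp
    then show ?thesis
      by (simp add: mult.assoc flip: exp_add)
  qed
  moreover have "\<delta> > 0"
    using \<open>s > 0\<close> b by (simp add: \<delta>_def)
  ultimately show ?thesis
    using that by blast
qed

lemma bowen_entropy_nonneg: "bowen_entropy Z \<ge> 0"
  unfolding bowen_entropy_def by (rule INF_greatest) simp

lemma bowen_entropy_mean_li_yorke_set:
  fixes \<omega> :: "nat \<Rightarrow> 'k::finite"
  shows "bowen_entropy (Metric_space.mean_li_yorke_set X rho shift \<omega>) = 0" (is "bowen_entropy ?Z = 0")
proof (rule antisym[OF _ bowen_entropy_nonneg], rule ereal_le_if_all_real_above)
  fix s assume "0 < ereal s"
  then have "s > 0"
    by simp
  \<comment> \<open>The exponent \<open>s / 2\<close> for the balls leaves room for a convergent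
    geometric series at exponent \<open>s\<close>.\<close>
  then obtain \<delta> where \<delta>: "\<delta> > 0"
    "\<And>n. real (card {W :: 'k list. length W = n \<and> real (card {i. i < n \<and> W ! i \<noteq> \<omega> i}) \<le> \<delta> * real n}) \<le> exp (s / 2 * real n)"
    using exists_hamming_ball_card_le[of "s / 2" \<omega>] by auto
  have "cylinder_null s ?Z"
    unfolding cylinder_null_def
  proof (intro allI impI)
    fix e :: real assume "e > 0"
    have "eventually (\<lambda>M. exp (s / 2 - s) ^ M / (1 - exp (s / 2 - s)) < e) sequentially"
      using \<open>s > 0\<close> \<open>e > 0\<close> by (intro order_tendstoD[OF geometric_tail_tendsto]) auto
    then obtain N where N: "exp (s / 2 - s) ^ N / (1 - exp (s / 2 - s)) < e"
      by (auto simp: eventually_sequentially)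
    \<comment> \<open>All lengths from \<open>N\<close> on enter at once, because the time at which
      \<open>y\<close> is close to \<open>\<omega>\<close> depends on \<open>y\<close>.\<close>
    define \<W> where "\<W> = {W :: 'k list. length W \<ge> N \<and> real (card {i. i < length W \<and> W ! i \<noteq> \<omega> i}) \<le> \<delta> * real (length W)}"
    have "(\<Sum>\<^sub>\<infinity>W\<in>\<W>. ennreal (exp (- s * real (length W)))) \<le> ennreal (exp (s / 2 - s) ^ N / (1 - exp (s / 2 - s)))"
    proof (rule infsum_words_le)
      fix n assume "n \<ge> N"
      then have "{W\<in>\<W>. length W = n} = {W. length W = n \<and> real (card {i. i < n \<and> W ! i \<noteq> \<omega> i}) \<le> \<delta> * real n}"
        by (auto simp: \<W>_def)
      then show "real (card {W\<in>\<W>. length W = n}) \<le> exp (s / 2 * real n)"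
        using \<delta>(2) by simp
    qed (use \<open>s > 0\<close> in \<open>auto simp: \<W>_def\<close>)
    also have "\<dots> \<le> ennreal e"
      using N by (intro ennreal_leI) simp
    finally have "(\<Sum>\<^sub>\<infinity>W\<in>\<W>. ennreal (exp (- s * real (length W)))) \<le> ennreal e" .
    moreover have "?Z \<subseteq> (\<Union>W\<in>\<W>. cylinder W)"
    proof
      fix y assume "y \<in> ?Z"
      then have "frequently (\<lambda>n. orbit_avg \<omega> y n < \<delta>) sequentially"
        using \<delta>(1) by (simp add: mean_li_yorke_set_iff)
      then have "frequently (\<lambda>n. orbit_avg \<omega> y n < \<delta> \<and> n \<ge> N) sequentially"
        by (rule frequently_eventually_frequently) (rule eventually_ge_at_top)
      then obtain n where n: "orbit_avg \<omega> y n < \<delta>" "n \<ge> N"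
        by (auto dest: frequently_ex)
      have "real (card {i. i < n \<and> \<omega> i \<noteq> y i}) \<le> orbit_avg \<omega> y n * real n"
        by (rule card_diff_le_orbit_avg)
      also have "\<dots> \<le> \<delta> * real n"
        using n(1) by (intro mult_right_mono) auto
      also have "{i. i < n \<and> \<omega> i \<noteq> y i} = {i. i < n \<and> pre y n ! i \<noteq> \<omega> i}"
        by auto
      finally have "pre y n \<in> \<W>"
        using n(2) by (simp add: \<W>_def)
      then show "y \<in> (\<Union>W\<in>\<W>. cylinder W)"
        by (intro UN_I[of "pre y n"]) (auto simp: mem_cylinder_pre_iff)
    qed
    ultimately show "\<exists>\<W>. ?Z \<subseteq> (\<Union>W\<in>\<W>. cylinder W) \<and>
        (\<Sum>\<^sub>\<infinity>W\<in>\<W>. ennreal (exp (- s * real (length W)))) \<le> ennreal e"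
      by blast
  qed
  with \<open>s > 0\<close> show "bowen_entropy ?Z \<le> ereal s"
    unfolding bowen_entropy_def by (intro INF_lower) (simp add: bowen_measure_eq_0_iff)
qed


section \<open>Packing measure of a closed set with many extensions\<close>

text \<open>Baire category by hand: otherwise every cylinder meeting \<open>E\<close> could be
  shrunk to one that meets \<open>E\<close> and avoids the next \<open>Y i\<close>, and the limit
  point would lie in \<open>E\<close> but in no \<open>Y i\<close>. The points at which
  \<open>Y i\<close> meets the small cylinders may lie outside \<open>E\<close>; a packing asks for
  no more.\<close>

lemma closed_Baire_cylinder:
  fixes E :: "(nat \<Rightarrow> 'k) set"
  assumes closed: "\<And>x. (\<And>n. pre x n \<in> words E n) \<Longrightarrow> x \<in> E" and "E \<noteq> {}"
    and cover: "E \<subseteq> (\<Union>i::nat. Y i)"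
  shows "\<exists>i V. E \<inter> cylinder V \<noteq> {} \<and> (\<forall>x\<in>E \<inter> cylinder V. \<forall>n. cylinder (pre x n) \<inter> Y i \<noteq> {})"
proof (rule ccontr)
  assume "\<not> ?thesis"
  then have avoid: "\<exists>x n. x \<in> E \<inter> cylinder V \<and> cylinder (pre x n) \<inter> Y i = {}"
    if "E \<inter> cylinder V \<noteq> {}" for i V
    using that by blast
  \<comment> \<open>A state is a point of \<open>E\<close> with a prefix length. The first conjunct
    is the invariant, and \<open>i \<le> snd (f i)\<close> drives the lengths to infinity.\<close>
  have "\<exists>f. \<forall>i. (fst (f i) \<in> E \<and> i \<le> snd (f i)) \<and> (snd (f i) < snd (f (Suc i)) \<and>
    (\<forall>k<snd (f i). fst (f (Suc i)) k = fst (f i) k) \<and>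
    cylinder (pre (fst (f (Suc i))) (snd (f (Suc i)))) \<inter> Y i = {})"
  proof (rule dependent_nat_choice)
    obtain x where "x \<in> E"
      using \<open>E \<noteq> {}\<close> by blast
    then show "\<exists>p. fst p \<in> E \<and> (0::nat) \<le> snd p"
      by (intro exI[of _ "(x, 0)"]) simp
  next
    fix p and i :: nat assume p: "fst p \<in> E \<and> i \<le> snd p"
    then have "fst p \<in> E \<inter> cylinder (pre (fst p) (snd p))"
      by (simp add: mem_cylinder_pre_iff)
    then obtain x n where x: "x \<in> E" "x \<in> cylinder (pre (fst p) (snd p))" "cylinder (pre x n) \<inter> Y i = {}"
      using avoid by blast
    have "cylinder (pre x (max n (Suc (snd p)))) \<subseteq> cylinder (pre x n)"
      by (auto simp: mem_cylinder_pre_iff)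
    with x(3) have "cylinder (pre x (max n (Suc (snd p)))) \<inter> Y i = {}"
      by blast
    with x p show "\<exists>q. (fst q \<in> E \<and> Suc i \<le> snd q) \<and> (snd p < snd q \<and>
        (\<forall>k<snd p. fst q k = fst p k) \<and> cylinder (pre (fst q) (snd q)) \<inter> Y i = {})"
      by (intro exI[of _ "(x, max n (Suc (snd p)))"]) (auto simp: mem_cylinder_pre_iff)
  qed
  then obtain f where f: "\<forall>i. (fst (f i) \<in> E \<and> i \<le> snd (f i)) \<and> (snd (f i) < snd (f (Suc i)) \<and>
    (\<forall>k<snd (f i). fst (f (Suc i)) k = fst (f i) k) \<and>
    cylinder (pre (fst (f (Suc i))) (snd (f (Suc i)))) \<inter> Y i = {})"
    by blast
  define x where "x i = fst (f i)" for i
  define m where "m i = snd (f i)" for i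
  have x_E: "x i \<in> E" and m_ge: "i \<le> m i" and m_less: "m i < m (Suc i)"
    and x_step: "\<And>k. k < m i \<Longrightarrow> x (Suc i) k = x i k"
    and x_avoid: "cylinder (pre (x (Suc i)) (m (Suc i))) \<inter> Y i = {}" for i
    using f unfolding x_def m_def by blast+
  have m_mono: "m i \<le> m j" if "i \<le> j" for i j
    by (rule lift_Suc_mono_le[of m, OF less_imp_le[OF m_less] that])
  have x_eq: "x j k = x i k" if "i \<le> j" "k < m i" for i j k
    using that(1)
  proof (induction j rule: dec_induct)
    case (step j)
    then show ?case
      using x_step[of k j] m_mono[of i j] that(2) by simp
  qed simp
  \<comment> \<open>Letter \<open>k\<close> is settled from stage \<open>k + 1\<close> on, since
    \<open>k < m (Suc k)\<close>.\<close>
  define z where "z k = x (Suc k) k" for k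
  have z_eq: "z k = x i k" if "k < m i" for i k
  proof (cases "i \<le> Suc k")
    case True
    then show ?thesis
      using x_eq[OF True that] by (simp add: z_def)
  next
    case False
    then have "k < m (Suc k)"
      using m_ge[of "Suc k"] by simp
    then show ?thesis
      using x_eq[of "Suc k" i k] False by (simp add: z_def)
  qed
  have "pre z n \<in> words E n" for n
  proof -
    have "pre z n = pre (x n) n"
      using z_eq[of _ n] m_ge[of n] by (simp add: pre_eq_iff)
    then show ?thesis
      using x_E[of n] by (auto simp: words_def)
  qed
  then have "z \<in> E"
    by (rule closed)
  then obtain i where "z \<in> Y i"
    using cover by blast
  moreover have "z \<in> cylinder (pre (x (Suc i)) (m (Suc i)))"
    using z_eq[of _ "Suc i"] by (simp add: mem_cylinder_pre_iff)
  ultimately show False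
    using x_avoid[of i] by blast
qed

text \<open>All words of \<open>E\<close> inside the Baire cylinder are admissible in a packing of
  the single set \<open>Y i\<close>, so the words of one good length give it content at least 1.
  That cylinder comes without any control over its position, which is why \<open>many\<close> is
  demanded of every cylinder that meets \<open>E\<close>.\<close>

lemma packing_measure_ge_1:
  fixes E :: "(nat \<Rightarrow> 'k::finite) set"
  assumes closed: "\<And>x. (\<And>n. pre x n \<in> words E n) \<Longrightarrow> x \<in> E" and "E \<noteq> {}" "E \<subseteq> Z"
    and many: "\<And>V N. E \<inter> cylinder V \<noteq> {} \<Longrightarrow> \<exists>n\<ge>N. exp (s * real n) \<le> real (card (words (E \<inter> cylinder V) n))"
  shows "packing_measure s Z \<ge> 1"
  unfolding packing_measure_def
proof (rule INF_greatest, elim CollectE)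
  fix Y :: "nat \<Rightarrow> (nat \<Rightarrow> 'k) set" assume "Z \<subseteq> (\<Union>i. Y i)"
  then have "E \<subseteq> (\<Union>i. Y i)"
    using \<open>E \<subseteq> Z\<close> by blast
  then obtain i V where V: "E \<inter> cylinder V \<noteq> {}"
    "\<And>x n. x \<in> E \<inter> cylinder V \<Longrightarrow> cylinder (pre x n) \<inter> Y i \<noteq> {}"
    using closed_Baire_cylinder[OF closed \<open>E \<noteq> {}\<close>, of Y] by blast
  have "1 \<le> packing_content s (Y i)"
    unfolding packing_content_eq_INF
  proof (rule INF_greatest)
    fix N
    obtain n where n: "n \<ge> N" "exp (s * real n) \<le> real (card (words (E \<inter> cylinder V) n))"
      using many[OF V(1)] by blast
    define \<W> where "\<W> = words (E \<inter> cylinder V) n"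
    have len: "length W = n" if "W \<in> \<W>" for W
      using that unfolding \<W>_def by (rule length_words)
    have "1 = exp (s * real n) * exp (- s * real n)"
      by (simp flip: exp_add)
    also have "\<dots> \<le> real (card \<W>) * exp (- s * real n)"
      using n(2) by (intro mult_right_mono) (auto simp: \<W>_def)
    finally have "1 \<le> ennreal (real (card \<W>) * exp (- s * real n))"
      by (simp add: ennreal_leI flip: ennreal_1)
    also have "\<dots> = ennreal (\<Sum>W\<in>\<W>. exp (- s * real (length W)))"
      by (simp add: len)
    also have "\<dots> = (\<Sum>W\<in>\<W>. ennreal (exp (- s * real (length W))))"
      by (rule sum_ennreal[symmetric]) simp
    also have "\<dots> \<le> (\<Sum>\<^sub>\<infinity>W\<in>\<W>. ennreal (exp (- s * real (length W))))"
      by (rule sum_le_infsum_ennreal) (simp_all add: \<W>_def)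
    also have "\<dots> \<le> packing_premeasure s N (Y i)"
      unfolding packing_premeasure_def
    proof (rule SUP_upper, rule CollectI, intro conjI ballI)
      show "pairwise (\<lambda>V W. disjnt (cylinder V) (cylinder W)) \<W>"
        by (auto simp: pairwise_def len intro!: disjnt_cylinder_same_length)
      fix W assume W: "W \<in> \<W>"
      then obtain x where "x \<in> E \<inter> cylinder V" "W = pre x n"
        unfolding \<W>_def words_def by blast
      then show "cylinder W \<inter> Y i \<noteq> {}"
        using V(2) by simp
      show "N \<le> length W"
        using n(1) len[OF W] by simp
    qed
    finally show "1 \<le> packing_premeasure s N (Y i)" .
  qed
  also have "\<dots> \<le> (\<Sum>i. packing_content s (Y i))"
    using sum_le_infsum_ennreal[of "{i}" UNIV "\<lambda>i. packing_content s (Y i)"]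
    by (simp add: suminf_eq_infsum_ennreal)
  finally show "1 \<le> (\<Sum>i. packing_content s (Y i))" .
qed


section \<open>Walks and loops\<close>

text \<open>A walk lists the states it visits, including its start and excluding its end.\<close>

fun walk :: "nat ^ 'k ^ 'k \<Rightarrow> 'k \<Rightarrow> 'k list \<Rightarrow> 'k \<Rightarrow> bool" where
  "walk A i [] j \<longleftrightarrow> i = j"
| "walk A i (x # w) j \<longleftrightarrow> x = i \<and> (\<exists>k. A $ x $ k = 1 \<and> walk A k w j)"

definition loops :: "nat ^ 'k ^ 'k \<Rightarrow> 'k \<Rightarrow> nat \<Rightarrow> 'k list set" where
  "loops A b L = {w. length w = L \<and> walk A b w b}"

lemma walk_append: "walk A i (u @ v) j \<longleftrightarrow> (\<exists>k. walk A i u k \<and> walk A k v j)"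
  by (induction u arbitrary: i) auto

lemma walk_nth_0: "walk A i w j \<Longrightarrow> w \<noteq> [] \<Longrightarrow> w ! 0 = i"
  by (cases w) auto

lemma walk_nth_Suc: "walk A i w j \<Longrightarrow> Suc n < length w \<Longrightarrow> A $ (w ! n) $ (w ! Suc n) = 1"
proof (induction w arbitrary: i n)
  case (Cons x w)
  then obtain k where k: "A $ x $ k = 1" "walk A k w j"
    by auto
  show ?case
  proof (cases n)
    case 0
    then show ?thesis
      using Cons.prems(2) k walk_nth_0[OF k(2)] by auto
  next
    case (Suc m)
    then show ?thesis
      using Cons.IH[OF k(2), of m] Cons.prems(2) by simp
  qed
qed simp

lemma SFT_shift: "x \<in> SFT A \<Longrightarrow> (\<lambda>i. x (n + i)) \<in> SFT A"
  by (simp add: SFT_def)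

lemma SFT_closed:
  assumes "\<And>n. pre x n \<in> words (SFT A) n"
  shows "x \<in> SFT A"
  unfolding SFT_def
proof (intro CollectI allI)
  fix i
  obtain y where "y \<in> SFT A" "pre x (Suc (Suc i)) = pre y (Suc (Suc i))"
    using assms[of "Suc (Suc i)"] unfolding words_def by blast
  then show "A $ x i $ x (Suc i) = 1"
    by (simp add: SFT_def pre_eq_iff)
qed

lemma walk_pre: "x \<in> SFT A \<Longrightarrow> walk A (x 0) (pre x n) (x n)"
proof (induction n)
  case (Suc n)
  have "pre x (Suc n) = pre x n @ [x n]"
    by (simp add: pre_def)
  then show ?case
    using Suc by (auto simp: walk_append SFT_def)
qed (simp add: pre_def)

lemma finite_loops [simp]: "finite (loops (A :: nat ^ 'k::finite ^ 'k) b L)"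
  by (rule finite_subset[OF _ finite_lists_length[of L]]) (auto simp: loops_def)

context
  fixes A :: "nat ^ 'k::finite ^ 'k"
  assumes entries: "\<And>i j. A $ i $ j \<in> {0, 1}"
begin

text \<open>A positive entry of a product of matrices over the naturals has a positive term, and
  \<open>entries\<close> turns a nonzero entry of \<open>A\<close> into an allowed step.\<close>

lemma matrix_pow_pos_imp_walk: "matrix_pow A r $ i $ j > 0 \<Longrightarrow> \<exists>w. length w = r \<and> walk A i w j"
proof (induction r arbitrary: i)
  case 0
  then show ?case
    by (simp add: mat_def split: if_splits)
next
  case (Suc r)
  have "matrix_pow A (Suc r) $ i $ j = (\<Sum>k\<in>UNIV. A $ i $ k * matrix_pow A r $ k $ j)"
    by (simp add: matrix_matrix_mult_def)
  with Suc.prems have "(\<Sum>k\<in>UNIV. A $ i $ k * matrix_pow A r $ k $ j) \<noteq> 0"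
    by linarith
  then obtain k where "A $ i $ k \<noteq> 0" "matrix_pow A r $ k $ j > 0"
    by (metis (no_types, lifting) bot_nat_0.not_eq_extremum mult_zero_left mult_zero_right sum.neutral)
  moreover from this have "A $ i $ k = 1"
    using entries[of i k] by auto
  ultimately show ?case
    using Suc.IH[of k] by (metis length_Cons walk.simps(2))
qed

text \<open>One of the \<open>K\<^sup>2\<close> pairs \<open>(i, j)\<close> accounts for many walks
  of length \<open>n\<close>; a fixed path from \<open>b\<close> to \<open>i\<close> before them and
  a fixed path from \<open>j\<close> to \<open>b\<close> after them turn these into loops of one
  common length. The \<open>+ 1\<close> in the conclusion allows one loop to be discarded
  later.\<close>

lemma exists_many_loops:
  assumes irr: "irreducible_matrix A" and "SFT A \<noteq> {}" and "s \<ge> 0" "ereal s < growth (SFT A)"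
  obtains L where "L > 0" "exp (s * real L) + 1 \<le> real (card (loops A b L))"
proof -
  have "\<exists>w. walk A i w j" for i j
    using irr matrix_pow_pos_imp_walk unfolding irreducible_matrix_def by metis
  then obtain path where path: "\<And>i j. walk A i (path i j) j"
    by metis
  define R where "R = Max (range (\<lambda>(i, j). length (path i j)))"
  have R: "length (path i j) \<le> R" for i j
  proof -
    have "(\<lambda>(i, j). length (path i j)) (i, j) \<le> R"
      unfolding R_def by (intro Max_ge) auto
    then show ?thesis
      by simp
  qed
  define K where "K = real CARD('k)"
  have "K > 0"
    by (simp add: K_def)
  obtain s1 where s1: "ereal s < ereal s1" "ereal s1 < growth (SFT A)"
    using ereal_dense2[OF assms(4)] by blast
  then have "s < s1"
    by simp
  \<comment> \<open>\<open>D\<close> collects the losses: \<open>K\<^sup>2\<close> from the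
    pigeonhole, \<open>exp (s * (2 * R))\<close> from the connecting paths, and 2 for the
    \<open>+ 1\<close>. The larger exponent \<open>s1\<close> absorbs them once \<open>n\<close> is
    large.\<close>
  define D where "D = ln (2 * K\<^sup>2 * exp (s * (2 * real R)))"
  have "eventually (\<lambda>n. D / (s1 - s) \<le> real n \<and> n > 0) sequentially"
    by (intro eventually_conj eventually_gt_at_top)
      (auto simp: eventually_sequentially intro!: exI[of _ "nat \<lceil>D / (s1 - s)\<rceil>"] dest: of_nat_mono[where 'a = real])
  then obtain n where n: "exp (s1 * real n) \<le> real (card (words (SFT A) n))"
    "D / (s1 - s) \<le> real n" "n > 0"
    using frequently_ex[OF frequently_eventually_frequently[OF frequently_card_words_ge[OF assms(2) s1(2)]]] by blast
  define T where "T i j = {w. length w = n \<and> walk A i w j}" for i j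
  have finT: "finite (T i j)" for i j
    by (rule finite_subset[OF _ finite_lists_length[of n]]) (auto simp: T_def)
  have "words (SFT A) n \<subseteq> (\<Union>(i, j)\<in>UNIV. T i j)"
    using walk_pre[of _ A n] by (fastforce simp: words_def T_def)
  then have "card (words (SFT A) n) \<le> card (\<Union>(i, j)\<in>UNIV. T i j)"
    using finT by (intro card_mono) auto
  also have "\<dots> \<le> (\<Sum>p\<in>UNIV. card (case p of (i, j) \<Rightarrow> T i j))"
    by (rule card_UN_le) simp
  finally have words_le: "real (card (words (SFT A) n)) \<le> (\<Sum>p\<in>UNIV. real (card (case p of (i, j) \<Rightarrow> T i j)))"
    by (simp flip: of_nat_sum)
  have "D \<le> (s1 - s) * real n"
    using n(2) \<open>s < s1\<close> by (simp add: field_simps)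
  then have "exp D \<le> exp ((s1 - s) * real n)"
    by simp
  then have "2 * K\<^sup>2 * exp (s * (2 * real R)) \<le> exp ((s1 - s) * real n)"
    using \<open>K > 0\<close> by (simp add: D_def)
  then have "2 * K\<^sup>2 * exp (s * (2 * real R)) * exp (s * real n) \<le> exp ((s1 - s) * real n) * exp (s * real n)"
    by (rule mult_right_mono) simp
  then have "K\<^sup>2 * (2 * exp (s * (real n + 2 * real R))) \<le> exp (s1 * real n)"
    by (simp add: algebra_simps flip: exp_add)
  with n(1) words_le have big: "K\<^sup>2 * (2 * exp (s * (real n + 2 * real R))) \<le> (\<Sum>p\<in>UNIV. real (card (case p of (i, j) \<Rightarrow> T i j)))"
    by linarith
  have "\<exists>p. 2 * exp (s * (real n + 2 * real R)) \<le> real (card (case p of (i, j) \<Rightarrow> T i j))"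
  proof (rule ccontr)
    assume "\<not> ?thesis"
    then have "(\<Sum>p\<in>UNIV. real (card (case p of (i, j) \<Rightarrow> T i j))) < (\<Sum>p\<in>(UNIV :: ('k \<times> 'k) set). 2 * exp (s * (real n + 2 * real R)))"
      by (intro sum_strict_mono) (auto simp: not_le)
    also have "\<dots> = K\<^sup>2 * (2 * exp (s * (real n + 2 * real R)))"
      by (simp add: K_def power2_eq_square)
    finally show False
      using big by simp
  qed
  then obtain i j where ij: "2 * exp (s * (real n + 2 * real R)) \<le> real (card (T i j))"
    by auto
  define L where "L = length (path b i) + n + length (path j b)"
  have "card (T i j) \<le> card (loops A b L)"
  proof (rule card_inj_on_le)
    show "inj_on (\<lambda>w. path b i @ w @ path j b) (T i j)"
      by (rule inj_onI) simp
    show "(\<lambda>w. path b i @ w @ path j b) ` T i j \<subseteq> loops A b L"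
    proof (rule image_subsetI)
      fix w assume "w \<in> T i j"
      then have "walk A b (path b i @ w @ path j b) b"
        unfolding walk_append using path by (auto simp: T_def)
      with \<open>w \<in> T i j\<close> show "path b i @ w @ path j b \<in> loops A b L"
        by (simp add: loops_def T_def L_def)
    qed
  qed simp
  moreover have "exp (s * real L) \<le> exp (s * (real n + 2 * real R))"
    using R[of b i] R[of j b] \<open>s \<ge> 0\<close> by (auto simp: L_def intro!: mult_left_mono)
  moreover have "1 \<le> exp (s * (real n + 2 * real R))"
    using \<open>s \<ge> 0\<close> by simp
  ultimately have "exp (s * real L) + 1 \<le> real (card (loops A b L))"
    using ij by linarith
  moreover have "L > 0"
    using n(3) by (simp add: L_def)
  ultimately show ?thesis
    using that by blast
qed

end


section \<open>Inserting free loops into an orbit\<close>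

text \<open>
  The point \<open>\<omega>\<close> is cut into blocks of length \<open>L\<close>, the \<open>j\<close>-th of them starting at \<open>start j\<close>. Inside the
  long windows \<open>{r (2 * k)..<r (2 * k + 1)}\<close> every block is replaced by an arbitrary loop at \<open>b\<close> other
  than the block of \<open>\<omega>\<close>. All \<open>start (r n)\<close> are congruent modulo \<open>L\<close>, so the windows hold a whole
  number of loops and the period of the shift plays no role.
\<close>

locale loop_insertion =
  fixes A :: "nat ^ 'k::finite ^ 'k" and \<omega> :: "nat \<Rightarrow> 'k" and b :: 'k and c L :: nat and r :: "nat \<Rightarrow> nat"
  assumes \<omega>_SFT: "\<omega> \<in> SFT A" and c_less: "c < L"
    and return: "\<And>n. \<omega> (c + r n * L) = b"
    and gap: "\<And>n. Suc n * Suc (r n) < r (Suc n)"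
    and two_loops: "card (loops A b L) \<ge> 2"
begin

definition start :: "nat \<Rightarrow> nat" where
  "start j = c + j * L"

definition block :: "(nat \<Rightarrow> 'k) \<Rightarrow> nat \<Rightarrow> 'k list" where
  "block y j = pre (\<lambda>i. y (start j + i)) L"

definition J :: "nat set" where
  "J = {j. \<exists>k. r (2 * k) \<le> j \<and> j < r (Suc (2 * k))}"

text \<open>Forbidding the block of \<open>\<omega>\<close> inside a window forces a disagreement in
  each of its blocks, which keeps the limsup of the averages positive at the price of at most one
  loop per block.\<close>

definition choices :: "nat \<Rightarrow> 'k list set" where
  "choices j = (if j \<in> J then loops A b L - {block \<omega> j} else {block \<omega> j})"

definition E :: "(nat \<Rightarrow> 'k) set" where
  "E = {y. (\<forall>i<c. y i = \<omega> i) \<and> (\<forall>j. block y j \<in> choices j)}"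

lemma L_pos: "L > 0"
  using c_less by simp

lemma start_Suc: "start (Suc j) = start j + L"
  by (simp add: start_def)

lemma le_start: "j \<le> start j"
proof -
  have "j * 1 \<le> j * L"
    using L_pos by (intro mult_le_mono) auto
  then show ?thesis
    unfolding start_def by linarith
qed

lemma start_mono: "i \<le> j \<Longrightarrow> start i \<le> start j"
  by (simp add: start_def)

lemma length_block [simp]: "length (block y j) = L"
  by (simp add: block_def)

lemma nth_block: "i < L \<Longrightarrow> block y j ! i = y (start j + i)"
  by (simp add: block_def)

lemma start_cases:
  assumes "c \<le> i"
  obtains j l where "i = start j + l" "l < L"
proof
  show "i = start ((i - c) div L) + (i - c) mod L"
    using assms by (simp add: start_def)
qed (use L_pos in simp)

lemma start_add_eq_iff:
  assumes "l < L" "l' < L"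
  shows "start j + l = start j' + l' \<longleftrightarrow> j = j' \<and> l = l'"
proof
  assume eq: "start j + l = start j' + l'"
  have "j * L + l = j' * L + l'"
    using eq by (simp add: start_def)
  then have "(j * L + l) div L = (j' * L + l') div L" "(j * L + l) mod L = (j' * L + l') mod L"
    by simp_all
  then show "j = j' \<and> l = l'"
    using assms by simp
qed simp

lemma r_less: "r n < r (Suc n)"
  using gap[of n] by simp

lemma strict_mono_r: "strict_mono r"
  using r_less by (simp add: strict_mono_Suc_iff)

lemma r_less_iff: "r m < r n \<longleftrightarrow> m < n"
  using strict_mono_r by (rule strict_mono_less)

lemma le_r: "n \<le> r n"
  using strict_mono_r by (rule strict_mono_imp_increasing)

lemma in_J: "r (2 * k) \<le> j \<Longrightarrow> j < r (Suc (2 * k)) \<Longrightarrow> j \<in> J"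
  by (auto simp: J_def)

lemma not_in_J:
  assumes "r (Suc (2 * k)) \<le> j" "j < r (2 * k + 2)"
  shows "j \<notin> J"
proof
  assume "j \<in> J"
  then obtain k' where k': "r (2 * k') \<le> j" "j < r (Suc (2 * k'))"
    by (auto simp: J_def)
  then have "r (2 * k') < r (2 * k + 2)" "r (Suc (2 * k)) < r (Suc (2 * k'))"
    using assms by linarith+
  then show False
    by (simp add: r_less_iff)
qed

text \<open>Membership in \<open>J\<close> changes only at some \<open>r n\<close>, where
  \<open>return\<close> puts the letter \<open>b\<close> into \<open>\<omega>\<close>. Hence loops
  at \<open>b\<close> and blocks of \<open>\<omega>\<close> fit together at every seam.\<close>

lemma switch:
  assumes "(j \<in> J) \<noteq> (Suc j \<in> J)"
  shows "\<omega> (start (Suc j)) = b"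
proof -
  obtain n where "Suc j = r n"
  proof (cases "j \<in> J")
    case True
    then obtain k where k: "r (2 * k) \<le> j" "j < r (Suc (2 * k))"
      by (auto simp: J_def)
    with True assms have "\<not> Suc j < r (Suc (2 * k))"
      using in_J[of k "Suc j"] by auto
    with k show ?thesis
      by (intro that[of "Suc (2 * k)"]) simp
  next
    case False
    with assms obtain k where k: "r (2 * k) \<le> Suc j" "Suc j < r (Suc (2 * k))"
      by (auto simp: J_def)
    with False have "\<not> r (2 * k) \<le> j"
      using in_J[of k j] by auto
    with k show ?thesis
      by (intro that[of "2 * k"]) simp
  qed
  then show ?thesis
    using return[of n] by (simp only: start_def)
qed

lemma start_0:
  assumes "0 \<in> J"
  shows "\<omega> (start 0) = b"
proof -
  obtain k where "r (2 * k) = 0"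
    using assms by (auto simp: J_def)
  then show ?thesis
    using return[of "2 * k"] by (simp add: start_def)
qed

lemma choices_length: "w \<in> choices j \<Longrightarrow> length w = L"
  by (auto simp: choices_def loops_def split: if_splits)

lemma card_choices: "j \<in> J \<Longrightarrow> card (choices j) \<ge> card (loops A b L) - 1"
  by (simp add: choices_def card_Diff_singleton_if)

lemma choices_nonempty: "choices j \<noteq> {}"
proof (cases "j \<in> J")
  case True
  then have "card (choices j) > 0"
    using card_choices[OF True] two_loops by linarith
  then show ?thesis
    by auto
qed (simp add: choices_def)

lemma eq_iff_blocks_eq:
  "(\<forall>i<start q. y i = z i) \<longleftrightarrow> (\<forall>i<c. y i = z i) \<and> (\<forall>j<q. block y j = block z j)"
proof (intro iffI conjI allI impI)
  fix j assume *: "\<forall>i<start q. y i = z i" "j < q"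
  then have "start (Suc j) \<le> start q"
    by (intro start_mono) simp
  with *(1) show "block y j = block z j"
    by (auto simp: block_def pre_eq_iff start_Suc)
next
  fix i assume *: "(\<forall>i<c. y i = z i) \<and> (\<forall>j<q. block y j = block z j)" "i < start q"
  show "y i = z i"
  proof (cases "i < c")
    case False
    then obtain j l where jl: "i = start j + l" "l < L"
      using start_cases[of i] by auto
    have "j < q"
      using *(2) start_mono[of q j] jl(1) by (cases "j < q") auto
    with * have "block y j ! l = block z j ! l"
      by simp
    then show ?thesis
      using jl by (simp add: nth_block)
  qed (use * in simp)
qed (auto simp: start_def)

text \<open>A right inverse of \<open>block\<close> on families of words of length \<open>L\<close>;
  it reduces the construction of points of \<open>E\<close> to a separate choice for each
  block.\<close>

definition assemble :: "(nat \<Rightarrow> 'k list) \<Rightarrow> nat \<Rightarrow> 'k" where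
  "assemble w i = (if i < c then \<omega> i else w ((i - c) div L) ! ((i - c) mod L))"

lemma block_assemble:
  assumes "length (w j) = L"
  shows "block (assemble w) j = w j"
  using assms L_pos by (intro nth_equalityI) (auto simp: nth_block assemble_def start_def)

lemma assemble_in_E:
  assumes "\<And>j. w j \<in> choices j"
  shows "assemble w \<in> E"
proof -
  have "block (assemble w) j = w j" for j
    using choices_length[OF assms] by (rule block_assemble)
  then show ?thesis
    using assms by (simp add: E_def assemble_def)
qed

lemma E_nonempty: "E \<noteq> {}"
proof -
  have "assemble (\<lambda>j. SOME w. w \<in> choices j) \<in> E"
    using choices_nonempty by (intro assemble_in_E) (simp add: some_in_eq)
  then show ?thesis
    by blast
qed

lemma E_closed:
  assumes "\<And>n. pre x n \<in> words E n"
  shows "x \<in> E"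
proof -
  have agree: "\<exists>y\<in>E. (\<forall>i<c. x i = y i) \<and> block x j = block y j" for j
  proof -
    obtain y where "y \<in> E" "pre x (start (Suc j)) = pre y (start (Suc j))"
      using assms[of "start (Suc j)"] unfolding words_def by blast
    then show ?thesis
      using eq_iff_blocks_eq[of "Suc j" x y] by (auto simp: pre_eq_iff)
  qed
  have "\<forall>i<c. x i = \<omega> i"
    using agree[of 0] by (auto simp: E_def)
  moreover have "block x j \<in> choices j" for j
    using agree[of j] by (auto simp: E_def)
  ultimately show ?thesis
    by (simp add: E_def)
qed

text \<open>Membership in \<open>E\<close> is decided block by block, so a block inside a window can
  be chosen independently of the prefix before it and multiplies the count by the number of its
  choices. As \<open>V\<close> ends by \<open>start p\<close>, these changes stay inside its
  cylinder.\<close>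

lemma card_words_E_ge:
  assumes "E \<inter> cylinder V \<noteq> {}" "length V \<le> start p" "p \<le> q" "{p..<q} \<subseteq> J"
  shows "card (words (E \<inter> cylinder V) (start q)) \<ge> (card (loops A b L) - 1) ^ (q - p)"
  using assms(3,4)
proof (induction q rule: dec_induct)
  case base
  then show ?case
    using card_words_pos[OF assms(1), of "start p"] by simp
next
  case (step q)
  define S where "S = words (E \<inter> cylinder V) (start q) \<times> choices q"
  have "{p..<q} \<subseteq> J" "q \<in> J"
    using step.prems step.hyps by auto
  then have "(card (loops A b L) - 1) ^ (q - p) * (card (loops A b L) - 1) \<le>
      card (words (E \<inter> cylinder V) (start q)) * card (choices q)"
    by (intro mult_le_mono step.IH card_choices)
  also have "\<dots> = card S"
    by (simp add: S_def card_cartesian_product)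
  also have "card S \<le> card (words (E \<inter> cylinder V) (start (Suc q)))"
  proof (rule card_inj_on_le)
    show "inj_on (\<lambda>(u, w). u @ w) S"
    proof (rule inj_onI, clarify)
      fix u w u' w' assume "(u, w) \<in> S" "(u', w') \<in> S" "u @ w = u' @ w'"
      then have "u \<in> words (E \<inter> cylinder V) (start q)" "u' \<in> words (E \<inter> cylinder V) (start q)"
        unfolding S_def by blast+
      from this[THEN length_words] have "length u = length u'"
        by (rule trans[OF _ sym])
      with \<open>u @ w = u' @ w'\<close> show "u = u' \<and> w = w'"
        using append_eq_append_conv[of u u' w w'] by simp
    qed
    show "(\<lambda>(u, w). u @ w) ` S \<subseteq> words (E \<inter> cylinder V) (start (Suc q))"
    proof (clarsimp simp: S_def)
      fix u w assume "u \<in> words (E \<inter> cylinder V) (start q)" and w: "w \<in> choices q"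
      then obtain y where y: "y \<in> E" "y \<in> cylinder V" "u = pre y (start q)"
        by (auto simp: words_def)
      \<comment> \<open>Only block \<open>q\<close> of \<open>y\<close> is exchanged, so
        \<open>z\<close> stays in \<open>E\<close> and keeps the prefix \<open>u\<close>.\<close>
      define z where "z = assemble (\<lambda>j. if j = q then w else block y j)"
      have z: "z \<in> E"
        unfolding z_def using y(1) w by (intro assemble_in_E) (auto simp: E_def)
      have blk: "block z j = (if j = q then w else block y j)" for j
        unfolding z_def using choices_length[OF w] by (intro block_assemble) simp
      have "\<forall>i<c. y i = z i"
        using y(1) by (simp add: z_def assemble_def E_def)
      then have "\<forall>i<start q. y i = z i"
        unfolding eq_iff_blocks_eq using blk by simp
      then have pre_z: "pre z (start q) = u"
        using y(3) by (simp add: pre_eq_iff)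
      have "length V \<le> start q"
        using assms(2) start_mono[OF step.hyps(1)] by simp
      with y(2) \<open>\<forall>i<start q. y i = z i\<close> have "z \<in> cylinder V"
        by (auto simp: cylinder_def)
      moreover have "pre z (start (Suc q)) = u @ w"
        using blk[of q] pre_z by (simp add: start_Suc pre_add block_def)
      ultimately show "u @ w \<in> words (E \<inter> cylinder V) (start (Suc q))"
        using z by (auto simp: words_def intro!: image_eqI[of _ _ z])
    qed
  qed simp
  finally show ?case
    using step.hyps by (simp add: Suc_diff_le mult.commute)
qed

text \<open>Each block is a walk from its first letter to the first letter of the next block: a loop
  inside a window, a piece of \<open>\<omega>\<close> elsewhere, with \<open>switch\<close> matching
  the ends at the seams. The concatenated walks contain every transition of
  \<open>y\<close>.\<close>

lemma E_subset_SFT: "E \<subseteq> SFT A"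
proof
  fix y assume y: "y \<in> E"
  have blk: "block y j \<in> choices j" for j
    using y by (simp add: E_def)
  have first: "y (start j) = block y j ! 0" for j
    using L_pos by (simp add: nth_block)
  have loop: "walk A b (block y j) b" if "j \<in> J" for j
    using blk[of j] that by (simp add: choices_def loops_def)
  have at_J: "y (start j) = b" if "j \<in> J" for j
  proof -
    have "block y j \<noteq> []"
      using L_pos by (metis length_block less_numeral_extra(3) list.size(3))
    then show ?thesis
      using walk_nth_0[OF loop[OF that]] first by simp
  qed
  have off_J: "block y j = block \<omega> j" if "j \<notin> J" for j
    using blk[of j] that by (simp add: choices_def)
  then have off_J_start: "y (start j) = \<omega> (start j)" if "j \<notin> J" for j
    using first[of j] off_J[OF that] nth_block[OF L_pos, of \<omega> j] by simp
  have step: "walk A (y (start j)) (block y j) (y (start (Suc j)))" for j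
  proof (cases "j \<in> J")
    case True
    then have "y (start (Suc j)) = b"
      using at_J[of "Suc j"] off_J_start[of "Suc j"] switch[of j] by (cases "Suc j \<in> J") auto
    then show ?thesis
      using loop[OF True] at_J[OF True] by simp
  next
    case False
    have "y (start (Suc j)) = \<omega> (start (Suc j))"
      using False at_J[of "Suc j"] off_J_start[of "Suc j"] switch[of j] by (cases "Suc j \<in> J") auto
    moreover have "walk A (\<omega> (start j)) (block \<omega> j) (\<omega> (start (Suc j)))"
      using walk_pre[OF SFT_shift[OF \<omega>_SFT, of "start j"], of L] by (simp add: block_def start_Suc)
    ultimately show ?thesis
      using False off_J off_J_start by simp
  qed
  have walks: "walk A (y 0) (pre y (start j)) (y (start j))" for j
  proof (induction j)
    case 0
    have "y (start 0) = \<omega> (start 0)"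
      using at_J[of 0] off_J_start[of 0] start_0 by (cases "0 \<in> J") auto
    moreover have "pre y c = pre \<omega> c"
      using y by (simp add: E_def pre_eq_iff)
    \<comment> \<open>For \<open>c = 0\<close> the initial segment is empty and \<open>y 0\<close>
      is already the first letter of block 0.\<close>
    moreover have "y 0 = \<omega> 0"
    proof (cases "c = 0")
      case True
      then show ?thesis
        using \<open>y (start 0) = \<omega> (start 0)\<close> unfolding start_def by simp
    next
      case False
      then show ?thesis
        using y unfolding E_def by blast
    qed
    ultimately show ?case
      using walk_pre[OF \<omega>_SFT, of c] by (simp add: start_def)
  next
    case (Suc j)
    then show ?case
      using step[of j] by (auto simp: start_Suc pre_add walk_append block_def)
  qed
  show "y \<in> SFT A"
    unfolding SFT_def
  proof (intro CollectI allI)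
    fix i
    have len: "Suc i < start (Suc (Suc i))"
      using le_start[of "Suc (Suc i)"] by simp
    have "Suc i < length (pre y (start (Suc (Suc i))))"
      using len by simp
    from walk_nth_Suc[OF walks this] len show "A $ y i $ y (Suc i) = 1"
      by simp
  qed
qed

lemma CARD_ge_2: "CARD('k) \<ge> 2"
proof (rule ccontr)
  assume "\<not> CARD('k) \<ge> 2"
  then have "CARD('k) = 1"
    using zero_less_card_finite[where 'a = 'k] by linarith
  then have "card {w :: 'k list. length w = L} = 1"
    by (simp add: card_lists_length)
  moreover have "card (loops A b L) \<le> card {w :: 'k list. length w = L}"
    by (intro card_mono finite_lists_length) (auto simp: loops_def)
  ultimately show False
    using two_loops by simp
qed

text \<open>Before \<open>m\<close> each distance is at most 1. From \<open>m\<close> on, the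
  \<open>i\<close>-th shifts agree on \<open>n - i\<close> letters, so their distances are bounded
  by \<open>(1/2) ^ (n - i)\<close>, and these terms sum to at most 1.\<close>

lemma sum_rho_le:
  assumes "m \<le> n" "\<And>i. m \<le> i \<Longrightarrow> i < n \<Longrightarrow> x i = (y i :: 'k)"
  shows "(\<Sum>i<n. rho ((shift ^^ i) x) ((shift ^^ i) y)) \<le> real m + 1"
proof -
  have geometric: "(\<Sum>i=m..<n. (1/2) ^ (n - i)) = 1 - (1/2 :: real) ^ (n - m)"
    using assms(1)
  proof (induction n rule: dec_induct)
    case (step n)
    have "(\<Sum>i=m..<n. (1/2) ^ (Suc n - i)) = (\<Sum>i=m..<n. (1/2) * (1/2 :: real) ^ (n - i))"
      by (rule sum.cong) (auto simp: Suc_diff_le)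
    also have "\<dots> = 1/2 * (1 - (1/2) ^ (n - m))"
      by (simp only: sum_distrib_left[symmetric] step.IH)
    finally show ?case
      using step.hyps by (simp add: Suc_diff_le field_simps)
  qed simp
  have near: "rho ((shift ^^ i) x) ((shift ^^ i) y) \<le> (1/2) ^ (n - i)" if "m \<le> i" "i < n" for i
  proof -
    have "rho ((shift ^^ i) x) ((shift ^^ i) y) \<le> inverse (real CARD('k) ^ (n - i))"
      unfolding rho_le_iff[OF CARD_ge_2] shift_funpow using assms(2) that by auto
    also have "\<dots> \<le> inverse (2 ^ (n - i))"
      using CARD_ge_2 by (intro le_imp_inverse_le power_mono) auto
    finally show ?thesis
      by (simp add: power_divide inverse_eq_divide)
  qed
  have "(\<Sum>i<n. rho ((shift ^^ i) x) ((shift ^^ i) y)) =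
      (\<Sum>i<m. rho ((shift ^^ i) x) ((shift ^^ i) y)) + (\<Sum>i=m..<n. rho ((shift ^^ i) x) ((shift ^^ i) y))"
    using assms(1) sum.atLeastLessThan_concat[of 0 m n "\<lambda>i. rho ((shift ^^ i) x) ((shift ^^ i) y)"]
    by (simp add: atLeast0LessThan)
  also have "\<dots> \<le> (\<Sum>i<m. 1) + (\<Sum>i=m..<n. (1/2) ^ (n - i))"
    using near by (intro add_mono sum_mono) (auto simp: rho_le_1)
  also have "\<dots> \<le> real m + 1"
    by (simp add: geometric)
  finally show ?thesis .
qed

text \<open>The offset \<open>c < L\<close> is absorbed into one extra block.\<close>

lemma real_start_less: "real (start j) + 1 \<le> (real j + 1) * real L"
proof -
  have "start j + 1 \<le> (j + 1) * L"
    using c_less by (simp add: start_def)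
  then have "real (start j + 1) \<le> real ((j + 1) * L)"
    by (rule of_nat_mono)
  then show ?thesis
    by (simp add: algebra_simps)
qed

lemma real_gap: "(real n + 1) * (real (r n) + 1) < real (r (Suc n))"
proof -
  have "real (Suc n * Suc (r n)) < real (r (Suc n))"
    using gap[of n] by (rule of_nat_less_iff[THEN iffD2])
  then show ?thesis
    by (simp add: algebra_simps)
qed

text \<open>At the end of a copied stretch all disagreements lie before \<open>start p\<close>,
  hence among fewer than \<open>(p + 1) * L\<close> letters, whereas the prefix has at least
  \<open>q * L\<close> letters. The ratio is controlled by \<open>gap\<close>.\<close>

lemma orbit_avg_small:
  assumes y: "y \<in> E"
  shows "orbit_avg \<omega> y (start (r (2 * k + 2))) \<le> 1 / (real (2 * k) + 2)"
proof -
  define p where "p = r (Suc (2 * k))"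
  define q where "q = r (2 * k + 2)"
  have pq: "(real (2 * k) + 2) * (real p + 1) < real q"
    using real_gap[of "Suc (2 * k)"] by (simp add: p_def q_def add.commute)
  have "p \<le> q"
    unfolding p_def q_def using r_less[of "Suc (2 * k)"] by simp
  have agree: "\<omega> i = y i" if "start p \<le> i" "i < start q" for i
  proof -
    have "c \<le> i"
      using that(1) by (simp add: start_def)
    then obtain j l where jl: "i = start j + l" "l < L"
      by (rule start_cases)
    have "p \<le> j"
    proof (rule ccontr)
      assume "\<not> p \<le> j"
      then have "start (Suc j) \<le> start p"
        by (intro start_mono) simp
      then show False
        using jl that(1) by (simp add: start_Suc)
    qed
    moreover have "j < q"
      using that(2) jl start_mono[of q j] by (cases "j < q") auto
    ultimately have "j \<notin> J"
      unfolding p_def q_def by (rule not_in_J)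
    then have "block y j = block \<omega> j"
      using y by (auto simp: E_def choices_def split: if_splits)
    then have "block y j ! l = block \<omega> j ! l"
      by simp
    then show ?thesis
      using jl by (simp add: nth_block)
  qed
  have "(\<Sum>i<start q. rho ((shift ^^ i) \<omega>) ((shift ^^ i) y)) \<le> real (start p) + 1"
    using start_mono[OF \<open>p \<le> q\<close>] agree by (rule sum_rho_le)
  also have "\<dots> \<le> (real p + 1) * real L"
    by (rule real_start_less)
  finally have sum_le: "(\<Sum>i<start q. rho ((shift ^^ i) \<omega>) ((shift ^^ i) y)) \<le> (real p + 1) * real L" .
  have "(real (2 * k) + 2) * ((real p + 1) * real L) \<le> real q * real L"
    using pq by (simp add: mult.assoc[symmetric] mult_right_mono)
  also have "\<dots> \<le> real (start q)"
    by (simp add: start_def)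
  finally have "(real (2 * k) + 2) * ((real p + 1) * real L) \<le> real (start q)" .
  moreover have "(real (2 * k) + 2) * (\<Sum>i<start q. rho ((shift ^^ i) \<omega>) ((shift ^^ i) y))
      \<le> (real (2 * k) + 2) * ((real p + 1) * real L)"
    by (intro mult_left_mono sum_le) simp
  ultimately have "(real (2 * k) + 2) * (\<Sum>i<start q. rho ((shift ^^ i) \<omega>) ((shift ^^ i) y)) \<le> real (start q)"
    by linarith
  moreover have "real (start q) > 0"
    using le_start[of q] le_r[of "2 * k + 2"] by (simp add: q_def)
  ultimately show ?thesis
    unfolding orbit_avg_def q_def[symmetric] by (simp add: field_simps)
qed

text \<open>At the end of a window each of its \<open>q - p\<close> blocks holds a disagreement.
  This is at least half of \<open>q + 1\<close>, and \<open>(q + 1) * L\<close> bounds the length of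
  the prefix; hence the constant \<open>1 / (2 * L)\<close>.\<close>

lemma orbit_avg_large:
  assumes y: "y \<in> E" and "k \<ge> 1"
  shows "orbit_avg \<omega> y (start (r (Suc (2 * k)))) \<ge> 1 / (2 * real L)"
proof -
  define p where "p = r (2 * k)"
  define q where "q = r (Suc (2 * k))"
  have "(real (2 * k) + 1) * (real p + 1) < real q"
    using real_gap[of "2 * k"] by (simp add: p_def q_def)
  \<comment> \<open>For \<open>k \<ge> 1\<close> the gap factor is at least 3, which is enough for
    \<open>q - p \<ge> (q + 1) / 2\<close>.\<close>
  moreover have "3 * (real p + 1) \<le> (real (2 * k) + 1) * (real p + 1)"
    using \<open>k \<ge> 1\<close> by (intro mult_right_mono) auto
  ultimately have pq: "3 * (real p + 1) < real q"
    by linarith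
  have "\<exists>l<L. \<omega> (start j + l) \<noteq> y (start j + l)" if "j \<in> {p..<q}" for j
  proof -
    have "j \<in> J"
      using that in_J[of k j] by (simp add: p_def q_def)
    then have "block y j \<noteq> block \<omega> j"
      using y by (auto simp: E_def choices_def split: if_splits)
    then show ?thesis
      by (auto simp: block_def pre_eq_iff)
  qed
  then obtain l where l: "\<And>j. j \<in> {p..<q} \<Longrightarrow> l j < L" "\<And>j. j \<in> {p..<q} \<Longrightarrow> \<omega> (start j + l j) \<noteq> y (start j + l j)"
    by metis
  have "card {p..<q} \<le> card {i. i < start q \<and> \<omega> i \<noteq> y i}"
  proof (rule card_inj_on_le)
    show "inj_on (\<lambda>j. start j + l j) {p..<q}"
      using l(1) by (auto simp: inj_on_def start_add_eq_iff)
    show "(\<lambda>j. start j + l j) ` {p..<q} \<subseteq> {i. i < start q \<and> \<omega> i \<noteq> y i}"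
    proof (rule image_subsetI)
      fix j assume j: "j \<in> {p..<q}"
      then have "start (Suc j) \<le> start q"
        by (intro start_mono) simp
      then show "start j + l j \<in> {i. i < start q \<and> \<omega> i \<noteq> y i}"
        using l[OF j] by (simp add: start_Suc)
    qed
  qed simp
  then have "real (card {p..<q}) \<le> real (card {i. i < start q \<and> \<omega> i \<noteq> y i})"
    by (rule of_nat_mono)
  also have "\<dots> \<le> orbit_avg \<omega> y (start q) * real (start q)"
    by (rule card_diff_le_orbit_avg)
  also have "\<dots> \<le> orbit_avg \<omega> y (start q) * ((real q + 1) * real L)"
    using real_start_less[of q] by (intro mult_left_mono orbit_avg_nonneg) linarith
  finally have "real q - real p \<le> orbit_avg \<omega> y (start q) * ((real q + 1) * real L)"
    by simp
  moreover have "(real q + 1) / 2 \<le> real q - real p"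
    using pq by simp
  moreover have "(real q + 1) * (2 * real L * orbit_avg \<omega> y (start q)) = 2 * (orbit_avg \<omega> y (start q) * ((real q + 1) * real L))"
    by simp
  ultimately have "(real q + 1) * 1 \<le> (real q + 1) * (2 * real L * orbit_avg \<omega> y (start q))"
    by linarith
  then have "1 \<le> 2 * real L * orbit_avg \<omega> y (start q)"
    by (subst (asm) mult_le_cancel_left_pos) auto
  then show ?thesis
    using L_pos by (simp add: q_def field_simps)
qed

lemma E_subset_mean_li_yorke_set: "E \<subseteq> Metric_space.mean_li_yorke_set (SFT A) rho shift \<omega>"
proof
  fix y assume y: "y \<in> E"
  have large: "k \<le> start (r (Suc (2 * k)))" "k \<le> start (r (2 * k + 2))" for k
    using le_r[of "Suc (2 * k)"] le_start[of "r (Suc (2 * k))"]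
      le_r[of "2 * k + 2"] le_start[of "r (2 * k + 2)"] by linarith+
  have "frequently (\<lambda>n. orbit_avg \<omega> y n < \<delta>) sequentially" if "\<delta> > 0" for \<delta>
    unfolding frequently_sequentially
  proof
    fix N
    obtain k where k: "1 / (real (2 * k) + 2) < \<delta>" "N \<le> k"
    proof
      define k where "k = max N (nat \<lceil>1 / \<delta>\<rceil>)"
      have "1 / \<delta> \<le> real k"
        unfolding k_def by (meson max.cobounded2 of_nat_mono order_trans real_nat_ceiling_ge)
      then have "1 / \<delta> < real (2 * k) + 2"
        by simp
      then show "1 / (real (2 * k) + 2) < \<delta>"
        using \<open>\<delta> > 0\<close> by (simp add: field_simps)
      show "N \<le> k"
        by (simp add: k_def)
    qed
    then show "\<exists>n\<ge>N. orbit_avg \<omega> y n < \<delta>"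
      using orbit_avg_small[OF y, of k] large(2)[of k]
      by (intro exI[of _ "start (r (2 * k + 2))"]) linarith
  qed
  moreover have "frequently (\<lambda>n. orbit_avg \<omega> y n \<ge> 1 / (2 * real L)) sequentially"
    unfolding frequently_sequentially
  proof
    fix N
    show "\<exists>n\<ge>N. orbit_avg \<omega> y n \<ge> 1 / (2 * real L)"
      using orbit_avg_large[OF y, of "Suc N"] large(1)[of "Suc N"]
      by (intro exI[of _ "start (r (Suc (2 * Suc N)))"]) linarith
  qed
  moreover have "1 / (2 * real L) > 0"
    using L_pos by simp
  ultimately show "y \<in> Metric_space.mean_li_yorke_set (SFT A) rho shift \<omega>"
    unfolding mean_li_yorke_set_iff using y E_subset_SFT by blast
qed

text \<open>The window ending at block \<open>q\<close> offers at least \<open>exp (u * L)\<close>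
  choices for each of its \<open>q - p\<close> blocks, to be compared with
  \<open>exp (s * n)\<close> for \<open>n = start q\<close>, at most \<open>(q + 1) * L\<close>. The
  margin \<open>u - s\<close> pays for the \<open>p\<close> blocks before the window.\<close>

lemma E_many_words:
  assumes loops: "exp (u * real L) \<le> real (card (loops A b L) - 1)" and "0 \<le> s" "s < u"
    and V: "E \<inter> cylinder V \<noteq> {}"
  shows "\<exists>n\<ge>N. exp (s * real n) \<le> real (card (words (E \<inter> cylinder V) n))"
proof -
  \<comment> \<open>The last term ensures \<open>u \<le> (u - s) * (2 * k + 1)\<close>, matching the
    gap factor of window \<open>k\<close>; the other two place the window beyond \<open>N\<close>
    and beyond \<open>V\<close>.\<close>
  define k where "k = max (max N (length V)) (nat \<lceil>u / (u - s)\<rceil>)"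
  have "u / (u - s) \<le> real k"
    unfolding k_def by (meson max.cobounded2 of_nat_mono order_trans real_nat_ceiling_ge)
  then have "u \<le> (u - s) * real k"
    using \<open>s < u\<close> by (simp add: field_simps)
  also have "\<dots> \<le> (u - s) * (real (2 * k) + 1)"
    using \<open>s < u\<close> by (intro mult_left_mono) auto
  finally have uk: "u \<le> (u - s) * (real (2 * k) + 1)" .
  define p where "p = r (2 * k)"
  define q where "q = r (Suc (2 * k))"
  have pq: "(real (2 * k) + 1) * (real p + 1) < real q"
    using real_gap[of "2 * k"] by (simp add: p_def q_def)
  have "p \<le> q"
    unfolding p_def q_def using r_less[of "2 * k"] by simp
  have "k \<le> start p"
    using le_r[of "2 * k"] le_start[of p] by (simp add: p_def)
  moreover have "N \<le> k" "length V \<le> k"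
    by (simp_all add: k_def)
  ultimately have big: "N \<le> start q" "length V \<le> start p"
    using start_mono[OF \<open>p \<le> q\<close>] by linarith+
  have "u * (real p + 1) \<le> (u - s) * (real (2 * k) + 1) * (real p + 1)"
    using uk by (intro mult_right_mono) auto
  also have "\<dots> \<le> (u - s) * (real q + 1)"
    using pq \<open>s < u\<close> by (simp add: mult.assoc)
  finally have "s * (real q + 1) \<le> u * (real q - real p)"
    by (simp add: algebra_simps)
  then have "s * (real q + 1) * real L \<le> u * (real q - real p) * real L"
    by (rule mult_right_mono) simp
  moreover have "s * real (start q) \<le> s * ((real q + 1) * real L)"
    using real_start_less[of q] \<open>0 \<le> s\<close> by (intro mult_left_mono) auto
  ultimately have "s * real (start q) \<le> real (q - p) * (u * real L)"
    using \<open>p \<le> q\<close> by (simp add: of_nat_diff mult.assoc mult.commute mult.left_commute)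
  then have "exp (s * real (start q)) \<le> exp (real (q - p) * (u * real L))"
    by simp
  also have "\<dots> = exp (u * real L) ^ (q - p)"
    by (rule exp_of_nat_mult)
  also have "\<dots> \<le> real (card (loops A b L) - 1) ^ (q - p)"
    using loops by (intro power_mono) auto
  also have "\<dots> = real ((card (loops A b L) - 1) ^ (q - p))"
    by simp
  also have "\<dots> \<le> real (card (words (E \<inter> cylinder V) (start q)))"
    using in_J[of k] by (intro of_nat_mono card_words_E_ge V big \<open>p \<le> q\<close>) (auto simp: p_def q_def)
  finally show ?thesis
    using big(1) by blast
qed

end


section \<open>Packing entropy of the mean Li--Yorke set\<close>

text \<open>Some residue class modulo \<open>L\<close> contains infinitely many elements of
  \<open>P\<close>. For the occurrences of \<open>b\<close> this yields returns whose distances are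
  multiples of the loop length.\<close>

lemma infinite_exists_above_residue:
  fixes P :: "nat set"
  assumes "infinite P" "L > 0"
  obtains c where "c < L" "\<And>n. \<exists>j>n. c + j * L \<in> P"
proof -
  have "finite ((\<lambda>i. i mod L) ` P)"
    by (rule finite_subset[of _ "{..<L}"]) (use \<open>L > 0\<close> in auto)
  then obtain i0 where inf: "infinite {i\<in>P. i mod L = i0 mod L}"
    using pigeonhole_infinite[OF assms(1), of "\<lambda>i. i mod L"] by auto
  define c where "c = i0 mod L"
  have "\<exists>j>n. c + j * L \<in> P" for n
  proof -
    obtain i where i: "i > Suc n * L" "i \<in> P" "i mod L = c"
      using inf unfolding infinite_nat_iff_unbounded c_def by blast
    have "Suc n \<le> i div L"
      using i(1) \<open>L > 0\<close> by (simp add: less_eq_div_iff_mult_less_eq)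
    moreover have "c + i div L * L = i"
      using i(3) mod_div_mult_eq[of i L] by simp
    ultimately show ?thesis
      using i(2) by (intro exI[of _ "i div L"]) auto
  qed
  then show ?thesis
    using that[of c] \<open>L > 0\<close> by (simp add: c_def)
qed

lemma growth_le_packing_entropy_mean_li_yorke_set:
  fixes A :: "nat ^ 'k::finite ^ 'k"
  assumes entries: "\<And>i j. A $ i $ j \<in> {0, 1}" and irr: "irreducible_matrix A" and \<omega>: "\<omega> \<in> SFT A"
  shows "growth (SFT A) \<le> packing_entropy (Metric_space.mean_li_yorke_set (SFT A) rho shift \<omega>)"
  unfolding packing_entropy_def
proof (rule INF_greatest, elim CollectE conjE, rule ccontr)
  fix s :: real
  assume s: "s \<ge> 0" "packing_measure s (Metric_space.mean_li_yorke_set (SFT A) rho shift \<omega>) = 0"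
  assume "\<not> growth (SFT A) \<le> ereal s"
  then have "ereal s < growth (SFT A)"
    by simp
  \<comment> \<open>The margin \<open>u - s\<close> is what \<open>E_many_words\<close>
    consumes.\<close>
  then obtain u where u: "ereal s < ereal u" "ereal u < growth (SFT A)"
    using ereal_dense2 by blast
  obtain i0 where "infinite {i. \<omega> i = \<omega> i0}"
    using pigeonhole_infinite[of "UNIV :: nat set" \<omega>] by auto
  define b where "b = \<omega> i0"
  have inf: "infinite {i. \<omega> i = b}"
    unfolding b_def by fact
  obtain L where L: "L > 0" "exp (u * real L) + 1 \<le> real (card (loops A b L))"
  proof (rule exists_many_loops[OF entries irr])
    show "SFT A \<noteq> {}"
      using \<omega> by blast
    show "0 \<le> u"
      using s(1) u(1) by simp
  qed (rule u(2))
  obtain c where c: "c < L" "\<And>n. \<exists>j>n. c + j * L \<in> {i. \<omega> i = b}"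
    using infinite_exists_above_residue[OF inf L(1)] by blast
  \<comment> \<open>Occurrences of \<open>b\<close> in the chosen residue class exist beyond every
    bound, so each return can be taken past the gap required after the previous one.\<close>
  have "\<exists>r. \<forall>n. \<omega> (c + r n * L) = b \<and> Suc n * Suc (r n) < r (Suc n)"
  proof (rule dependent_nat_choice)
    show "\<exists>p. \<omega> (c + p * L) = b"
      using c(2) by blast
    show "\<exists>q. \<omega> (c + q * L) = b \<and> Suc n * Suc p < q" for p n
      using c(2)[of "Suc n * Suc p"] by blast
  qed
  then obtain r where r: "\<And>n. \<omega> (c + r n * L) = b" "\<And>n. Suc n * Suc (r n) < r (Suc n)"
    by blast
  have "1 \<le> exp (u * real L)"
    using u(1) s(1) by simp
  then have "real 2 \<le> real (card (loops A b L))"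
    using L(2) unfolding of_nat_numeral by linarith
  then have "card (loops A b L) \<ge> 2"
    by (simp only: of_nat_le_iff)
  then interpret loop_insertion A \<omega> b c L r
    by unfold_locales (use \<omega> c(1) r in auto)
  have "exp (u * real L) \<le> real (card (loops A b L) - 1)"
    using L(2) two_loops by (simp add: of_nat_diff)
  then have "packing_measure s (Metric_space.mean_li_yorke_set (SFT A) rho shift \<omega>) \<ge> 1"
    using s(1) u(1) by (intro packing_measure_ge_1[OF E_closed E_nonempty E_subset_mean_li_yorke_set] E_many_words) auto
  with s(2) show False
    by simp
qed

text \<open>With one letter \<open>rho\<close> vanishes and \<open>ln K = 0\<close>, so the relation
  between entropy and dimension carries no information and the dimension is computed
  directly.\<close>

lemma hausdorff_dim_eq_0_if_CARD_less_2:
  fixes Z :: "(nat \<Rightarrow> 'k::finite) set"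
  assumes "CARD('k) < 2"
  shows "Metric_space.hausdorff_dim UNIV rho Z = 0"
proof (rule antisym)
  have "(SUP (x, y)\<in>U \<times> U. rho x y) = 0" if "U \<noteq> {}" for U :: "(nat \<Rightarrow> 'k) set"
    using that by (simp add: rho_eq_0_if_CARD_less_2[OF assms])
  then have diam: "Metric_space.mdiameter rho U = 0" for U :: "(nat \<Rightarrow> 'k) set"
    by (simp add: Metric_space.mdiameter_def[OF Metric_space_rho])
  have "Metric_space.hausdorff_premeasure UNIV rho s \<delta> Z = 0" if "s > 0" "\<delta> > 0" for s \<delta>
  proof -
    have "Metric_space.hausdorff_gauge rho s Z = 0"
      using that by (simp add: Metric_space.hausdorff_gauge_def[OF Metric_space_rho] diam)
    then have "Metric_space.hausdorff_premeasure UNIV rho s \<delta> Z \<le> (\<Sum>i::nat. 0)"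
      unfolding Metric_space.hausdorff_premeasure_def[OF Metric_space_rho]
      using that by (intro INF_lower2[of "\<lambda>_. Z"]) (auto simp: diam mbounded_rho)
    then show ?thesis
      by simp
  qed
  then have null: "Metric_space.hausdorff_outer_measure UNIV rho s Z = 0" if "s > 0" for s
    using that by (simp add: Metric_space.hausdorff_outer_measure_def[OF Metric_space_rho])
  show "Metric_space.hausdorff_dim UNIV rho Z \<le> 0"
  proof (rule ereal_le_if_all_real_above)
    fix s assume "0 < ereal s"
    then show "Metric_space.hausdorff_dim UNIV rho Z \<le> ereal s"
      unfolding Metric_space.hausdorff_dim_def[OF Metric_space_rho] by (intro INF_lower) (simp add: null)
  qed
  show "0 \<le> Metric_space.hausdorff_dim UNIV rho Z"
    unfolding Metric_space.hausdorff_dim_def[OF Metric_space_rho] by (rule INF_greatest) simp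
qed

text \<open>This serves the one-letter alphabet, where all averages vanish and no point has a mean
  Li--Yorke partner.\<close>

lemma packing_dim_empty:
  "Metric_space.packing_dim UNIV rho ({} :: (nat \<Rightarrow> 'k::finite) set) = 0"
proof (rule antisym)
  have "C = {}" if "Metric_space.ball_packing UNIV rho \<delta> ({} :: (nat \<Rightarrow> 'k) set) C" for \<delta> C
    using that unfolding Metric_space.ball_packing_def[OF Metric_space_rho] by auto
  then have "Metric_space.ball_packing_premeasure UNIV rho 0 \<delta> ({} :: (nat \<Rightarrow> 'k) set) \<le> 0" for \<delta>
    unfolding Metric_space.ball_packing_premeasure_def[OF Metric_space_rho] by (intro SUP_least) force
  then have "Metric_space.ball_packing_content UNIV rho 0 ({} :: (nat \<Rightarrow> 'k) set) = 0"
    unfolding Metric_space.ball_packing_content_def[OF Metric_space_rho] by simp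
  then have "Metric_space.ball_packing_outer_measure UNIV rho 0 ({} :: (nat \<Rightarrow> 'k) set) \<le> (\<Sum>i::nat. 0)"
    unfolding Metric_space.ball_packing_outer_measure_def[OF Metric_space_rho]
    by (intro INF_lower2[of "\<lambda>_. {}"]) auto
  then show "Metric_space.packing_dim UNIV rho ({} :: (nat \<Rightarrow> 'k) set) \<le> 0"
    unfolding Metric_space.packing_dim_def[OF Metric_space_rho] zero_ereal_def by (intro INF_lower) simp
  show "0 \<le> Metric_space.packing_dim UNIV rho ({} :: (nat \<Rightarrow> 'k) set)"
    unfolding Metric_space.packing_dim_def[OF Metric_space_rho] by (rule INF_greatest) simp
qed

theorem theorem1p2:
  fixes A :: "nat ^ 'k ^ 'k" and \<omega> :: "nat \<Rightarrow> 'k"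
  assumes "\<And>i j. A $ i $ j \<in> {0, 1}"
    and "irreducible_matrix A"
    and "\<omega> \<in> SFT A"
  shows "bowen_entropy (Metric_space.mean_li_yorke_set (SFT A) rho shift \<omega>) = 0 \<and>
         packing_entropy (Metric_space.mean_li_yorke_set (SFT A) rho shift \<omega>) =
           Metric_space.topological_entropy (SFT A) rho shift \<and>
         Metric_space.hausdorff_dim UNIV rho (Metric_space.mean_li_yorke_set (SFT A) rho shift \<omega>) = 0 \<and>
         Metric_space.packing_dim UNIV rho (Metric_space.mean_li_yorke_set (SFT A) rho shift \<omega>) =
           Metric_space.hausdorff_dim UNIV rho (SFT A)"
proof -
  define Z where "Z = Metric_space.mean_li_yorke_set (SFT A) rho shift \<omega>"
  have ne: "SFT A \<noteq> {}"
    using assms(3) by blast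
  have "Z \<subseteq> SFT A"
    by (auto simp: Z_def mean_li_yorke_set_iff)
  have bowen: "bowen_entropy Z = 0"
    unfolding Z_def by (rule bowen_entropy_mean_li_yorke_set)
  have packing: "packing_entropy Z = growth (SFT A)"
    unfolding Z_def
  proof (rule antisym)
    show "growth (SFT A) \<le> packing_entropy (Metric_space.mean_li_yorke_set (SFT A) rho shift \<omega>)"
      by (rule growth_le_packing_entropy_mean_li_yorke_set[OF assms])
  qed (rule packing_entropy_le_growth[OF ne \<open>Z \<subseteq> SFT A\<close>[unfolded Z_def]])
  \<comment> \<open>The Hausdorff dimension of the subshift translates into its Bowen entropy, so
    this is what links it to the packing dimension.\<close>
  have bowen_SFT: "bowen_entropy (SFT A) = growth (SFT A)"
    using bowen_entropy_le_growth[OF ne] growth_le_bowen_entropy[OF ne SFT_closed SFT_shift] by (rule antisym)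
  have dims: "Metric_space.hausdorff_dim UNIV rho Z = 0 \<and>
      Metric_space.packing_dim UNIV rho Z = Metric_space.hausdorff_dim UNIV rho (SFT A)"
  \<comment> \<open>The factor \<open>ln K\<close> between entropies and dimensions can be cancelled
    only when it is positive.\<close>
  proof (cases "CARD('k) \<ge> 2")
    case True
    then have c: "0 < ereal (ln (real CARD('k)))" "ereal (ln (real CARD('k))) \<noteq> \<infinity>"
      by simp_all
    have "ereal (ln (real CARD('k))) * Metric_space.hausdorff_dim UNIV rho Z = 0"
      using bowen bowen_entropy_eq_hausdorff_dim[OF True, of Z] by simp
    moreover have "ereal (ln (real CARD('k))) * Metric_space.packing_dim UNIV rho Z =
        ereal (ln (real CARD('k))) * Metric_space.hausdorff_dim UNIV rho (SFT A)"
      using packing bowen_SFT packing_entropy_eq_packing_dim[OF True, of Z]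
        bowen_entropy_eq_hausdorff_dim[OF True, of "SFT A"] by simp
    ultimately show ?thesis
      using c True by (auto simp: ereal_mult_cancel_left)
  next
    case False
    then have card: "CARD('k) < 2"
      by simp
    have "orbit_avg \<omega> y n = 0" for y n
      by (simp add: orbit_avg_def rho_eq_0_if_CARD_less_2[OF card])
    then have "Z = {}"
      by (auto simp: Z_def mean_li_yorke_set_iff)
    then show ?thesis
      using packing_dim_empty hausdorff_dim_eq_0_if_CARD_less_2[OF card] by simp
  qed
  show ?thesis
    using bowen packing dims topological_entropy_eq_growth[OF ne] unfolding Z_def by simp
qed

end
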